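(* There exist nondiscrete $0$-dimensional spaces $X$ such that the group $C_p(X,\mathbb Z)$ is Pontryagin reflexive.
   Context: Spaces are Tikhonov; $0$-dimensional means having a base of clopen sets. $C_p(X,\mathbb Z)$ is the group of continuous maps $X\to\mathbb Z$ ($\mathbb Z$ discrete) with pointwise addition and the topology of pointwise convergence. For a topological abelian group $G$, $\widehat G$ is the group of continuous homomorphisms $G\to\mathbb T=\mathbb R/\mathbb Z$ with the compact-open topology; $G$ is Pontryagin reflexive if the evaluation map $\mathcal E:G\to\widehat{\widehat G}$, $\mathcal E(g)(\chi)=\chi(g)$, is a topological isomorphism. *)

theory Defs
  imports "HOL-Analysis.Analysis" "HOL-Algebra.Group"
begin

record 'a topgroup = "'a monoid" + gtop :: "'a topology"

definition top_ab_group :: "('a, 'b) topgroup_scheme \<Rightarrow> bool" where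
  "top_ab_group G \<longleftrightarrow> comm_group G \<and> topspace (gtop G) = carrier G \<and>
     continuous_map (prod_topology (gtop G) (gtop G)) (gtop G) (\<lambda>(x, y). x \<otimes>\<^bsub>G\<^esub> y) \<and>
     continuous_map (gtop G) (gtop G) (\<lambda>x. inv\<^bsub>G\<^esub> x)"

definition circle_group :: "complex topgroup" where
  "circle_group = \<lparr>carrier = sphere 0 1, mult = (*), one = 1,
                   gtop = top_of_set (sphere 0 1)\<rparr>"

definition characters :: "('a, 'b) topgroup_scheme \<Rightarrow> ('a \<Rightarrow> complex) set" where
  "characters G = {c. c \<in> hom G circle_group \<and>
                      continuous_map (gtop G) (gtop circle_group) c \<and>
                      c \<in> extensional (carrier G)}"

definition dual_group :: "('a, 'b) topgroup_scheme \<Rightarrow> ('a \<Rightarrow> complex) topgroup" where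
  "dual_group G = \<lparr>carrier = characters G,
     mult = (\<lambda>c d. \<lambda>x\<in>carrier G. c x * d x),
     one = (\<lambda>x\<in>carrier G. 1),
     gtop = topology_generated_by
       {{c \<in> characters G. c ` K \<subseteq> U} | K U.
          compactin (gtop G) K \<and> openin (gtop circle_group) U}\<rparr>"

definition evaluation :: "('a, 'b) topgroup_scheme \<Rightarrow> 'a \<Rightarrow> (('a \<Rightarrow> complex) \<Rightarrow> complex)" where
  "evaluation G g = (\<lambda>c\<in>carrier (dual_group G). c g)"

definition pontryagin_reflexive :: "('a, 'b) topgroup_scheme \<Rightarrow> bool" where
  "pontryagin_reflexive G \<longleftrightarrow>
     evaluation G \<in> iso G (dual_group (dual_group G)) \<and>
     homeomorphic_map (gtop G) (gtop (dual_group (dual_group G))) (evaluation G)"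

definition Cp_int :: "'a topology \<Rightarrow> ('a \<Rightarrow> int) topgroup" where
  "Cp_int X = \<lparr>carrier = {f. continuous_map X (euclidean :: int topology) f \<and> f \<in> extensional (topspace X)},
     mult = (\<lambda>f g. \<lambda>x\<in>topspace X. f x + g x),
     one = (\<lambda>x\<in>topspace X. 0),
     gtop = subtopology (product_topology (\<lambda>_. euclidean :: int topology) (topspace X))
              {f. continuous_map X (euclidean :: int topology) f \<and> f \<in> extensional (topspace X)}\<rparr>"

definition tikhonov_space :: "'a topology \<Rightarrow> bool" where
  "tikhonov_space X \<longleftrightarrow> completely_regular_space X \<and> Hausdorff_space X"

definition zero_dimensional :: "'a topology \<Rightarrow> bool" where
  "zero_dimensional X \<longleftrightarrow>
     (\<forall>U x. openin X U \<and> x \<in> U \<longrightarrow> (\<exists>V. openin X V \<and> closedin X V \<and> x \<in> V \<and> V \<subseteq> U))"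

end

theory Submission
  imports Defs
begin

text \<open>Let \<open>X\<close> carry a single non-isolated point \<open>p\<close> whose neighbourhoods are the sets containing
  \<open>p\<close> with complement of cardinality at most the continuum. Characters of \<open>C\<^sub>p(X, \<int>)\<close> depend on
  finitely many coordinates, so a continuous character of the dual group is evaluation at some
  function \<open>n : X \<rightarrow> \<int>\<close>. If \<open>n\<close> is discontinuous, testing continuity on a compact \<open>K \<subseteq> C\<^sub>p(X, \<int>)\<close>
  shows that for too many points \<open>x\<close> the sets \<open>{f \<in> K. f x \<noteq> f p}\<close> have positive intersection
  number; a caliber argument and compactness produce one \<open>f \<in> K\<close> that differs from \<open>f p\<close> too often.
  Compact sets of characters have finite joint support because countable sets of isolated points
  are clopen, so that finite boxes over them are compact in \<open>C\<^sub>p(X, \<int>)\<close>.\<close>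

section \<open>Sets of cardinality at most the continuum\<close>

text \<open>C_p(X, Z) is dense in Z^X and has the same characters as Z^X, whose bidual is all of
  Z^X. Reflexivity is thus decided by the compact sets alone: there must be enough of them to make
  the dual topology so fine that its compact sets are equicontinuous, yet so few that no
  discontinuous function on X becomes a continuous character of the dual. The second requirement
  fixes the cardinal: a family of too many sets of positive measure must contain a centered
  subfamily that is still too large. With "countable" in place of "continuum" this fails under the
  continuum hypothesis: enumerate the reals in type omega_1 and take compact sets of positive
  measure that avoid longer and longer initial segments. The continuum works outright, because a set
  of size at most c has at most c countable subsets. Smallness is phrased through ranges of
  functions on \<open>nat set\<close>, which keeps cardinal arithmetic out of the proof.\<close>

definition small :: "'a set \<Rightarrow> bool" where
  "small A \<longleftrightarrow> (\<exists>g :: nat set \<Rightarrow> 'a. A \<subseteq> range g)"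

lemma small_subset: "small B \<Longrightarrow> A \<subseteq> B \<Longrightarrow> small A"
  unfolding small_def by blast

lemma countable_imp_small:
  assumes "countable A"
  shows "small A"
proof -
  have "A \<subseteq> range (\<lambda>S. from_nat_into A (the_elem S))"
  proof
    fix x assume "x \<in> A"
    then have "x = from_nat_into A (the_elem {to_nat_on A x})"
      using assms by simp
    then show "x \<in> range (\<lambda>S. from_nat_into A (the_elem S))" by blast
  qed
  then show ?thesis unfolding small_def by blast
qed

text \<open>Two sets of naturals are packed into one, the first on the even and the second on the
  odd numbers: c * c = c in coded form.\<close>

lemma small_UN:
  fixes A :: "nat set \<Rightarrow> 'a set"
  assumes "\<And>i. small (A i)"
  shows "small (\<Union>i. A i)"
proof -
  obtain g :: "nat set \<Rightarrow> nat set \<Rightarrow> 'a" where g: "\<And>i. A i \<subseteq> range (g i)"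
    using assms unfolding small_def by metis
  have "(\<Union>i. A i) \<subseteq> range (\<lambda>S. g {n. 2 * n \<in> S} {n. Suc (2 * n) \<in> S})"
  proof
    fix x assume "x \<in> (\<Union>i. A i)"
    then obtain i j where x: "x = g i j" using g by blast
    let ?S = "(\<lambda>n. 2 * n) ` i \<union> (\<lambda>n. Suc (2 * n)) ` j"
    have "{n. 2 * n \<in> ?S} = i" "{n. Suc (2 * n) \<in> ?S} = j"
      by (auto; presburger)+
    then have "x = g {n. 2 * n \<in> ?S} {n. Suc (2 * n) \<in> ?S}" using x by simp
    then show "x \<in> range (\<lambda>S. g {n. 2 * n \<in> S} {n. Suc (2 * n) \<in> S})" by blast
  qed
  then show ?thesis unfolding small_def by blast
qed

lemma small_UN_small:
  fixes A :: "'b \<Rightarrow> 'a set"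
  assumes "small I" "\<And>i. i \<in> I \<Longrightarrow> small (A i)"
  shows "small (\<Union>i\<in>I. A i)"
proof -
  obtain g :: "nat set \<Rightarrow> 'b" where g: "I \<subseteq> range g"
    using assms(1) unfolding small_def by blast
  have "small (\<Union>S. if g S \<in> I then A (g S) else {})"
    by (intro small_UN) (auto intro: assms(2) countable_imp_small)
  then show ?thesis
    by (rule small_subset) (use g in fastforce)
qed

lemma small_Un: "small A \<Longrightarrow> small B \<Longrightarrow> small (A \<union> B)"
  using small_UN_small[of "{A, B}" id] by (auto intro: countable_imp_small)

text \<open>Cantor's diagonal argument excludes a map from \<open>nat set\<close> onto its own power
  set. This is why the final space has points of type \<open>nat set set\<close>.\<close>

lemma not_small_UNIV: "\<not> small (UNIV :: nat set set set)"
proof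
  assume "small (UNIV :: nat set set set)"
  then obtain g :: "nat set \<Rightarrow> nat set set" where "range g = UNIV"
    unfolding small_def by blast
  then show False using Cantors_theorem[of UNIV] by auto
qed

text \<open>Countably branching well-founded trees index the elements of the closure of a set under
  countably-ary operations; coding a tree by its labelled paths shows that there are only
  continuum many of them, so no transfinite iteration is needed.\<close>

datatype wtree = Leaf | Node "nat \<Rightarrow> wtree" "nat set"

text \<open>The empty path tells \<open>Node\<close> from \<open>Leaf\<close>, the paths
  \<open>[0, k]\<close> record the label, and a head \<open>Suc i\<close> leads into the
  \<open>i\<close>-th subtree; the shift by one keeps labels and descents apart.\<close>

primrec enc :: "wtree \<Rightarrow> nat list set" where
  "enc Leaf = {}"
| "enc (Node f r) =
    insert [] ({[0, k] |k. k \<in> r} \<union> {Suc i # q |i q. q \<in> (enc \<circ> f) i})"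

lemma inj_enc: "inj enc"
proof (rule injI)
  fix s t show "enc s = enc t \<Longrightarrow> s = t"
  proof (induction s arbitrary: t)
    case Leaf
    then show ?case by (cases t) auto
  next
    case (Node f r)
    then obtain f' r' where t: "t = Node f' r'" by (cases t) auto
    have "k \<in> r \<longleftrightarrow> k \<in> r'" for k
    proof -
      have "k \<in> r \<longleftrightarrow> [0, k] \<in> enc (Node f r)" by auto
      also have "\<dots> \<longleftrightarrow> k \<in> r'" unfolding Node.prems t by auto
      finally show ?thesis .
    qed
    moreover have "f i = f' i" for i
    proof (rule Node.IH)
      have "q \<in> enc (f i) \<longleftrightarrow> q \<in> enc (f' i)" for q
      proof -
        have "q \<in> enc (f i) \<longleftrightarrow> Suc i # q \<in> enc (Node f r)" by auto
        also have "\<dots> \<longleftrightarrow> q \<in> enc (f' i)" unfolding Node.prems t by auto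
        finally show ?thesis .
      qed
      then show "enc (f i) = enc (f' i)" by blast
    qed simp
    ultimately show ?case unfolding t by auto
  qed
qed

primrec tree_eval :: "'a \<Rightarrow> ('a set \<Rightarrow> nat set \<Rightarrow> 'a) \<Rightarrow> wtree \<Rightarrow> 'a" where
  "tree_eval a en Leaf = a"
| "tree_eval a en (Node f r) = en (range (tree_eval a en \<circ> f)) r"

text \<open>A node whose subtrees evaluate to the points of a countable \<open>C\<close> picks,
  through its label, an element from an enumeration of \<open>W C\<close>. The values of all trees
  are therefore closed under \<open>W\<close>, and they form a small set because a tree is coded by
  a set of naturals. The enumeration may overshoot \<open>W C\<close>, which is harmless: only an
  upper bound on the size of \<open>M\<close> matters.\<close>

lemma small_closure:
  fixes W :: "'a set \<Rightarrow> 'a set"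
  assumes "\<And>C. countable C \<Longrightarrow> small (W C)"
  obtains M where "small M" "M \<noteq> {}"
    "\<And>C. C \<subseteq> M \<Longrightarrow> countable C \<Longrightarrow> C \<noteq> {} \<Longrightarrow> W C \<subseteq> M"
proof -
  obtain en :: "'a set \<Rightarrow> nat set \<Rightarrow> 'a" where en: "\<And>C. countable C \<Longrightarrow> W C \<subseteq> range (en C)"
    using assms unfolding small_def by metis
  define ev where "ev = tree_eval undefined en"
  define M where "M = range ev"
  have "inj (\<lambda>t. to_nat ` enc t)"
    using inj_enc by (auto simp: inj_def inj_image_eq_iff)
  then have "ev t = ev (inv_into UNIV (\<lambda>t. to_nat ` enc t) (to_nat ` enc t))" for t
    using inv_f_f by metis
  then have "M \<subseteq> range (\<lambda>S. ev (inv_into UNIV (\<lambda>t. to_nat ` enc t) S))"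
    unfolding M_def by blast
  then have "small M" unfolding small_def by blast
  moreover have "M \<noteq> {}" unfolding M_def by simp
  moreover have "W C \<subseteq> M" if C: "C \<subseteq> M" "countable C" "C \<noteq> {}" for C
  proof -
    obtain c :: "nat \<Rightarrow> 'a" where c: "C = range c"
      using C by (metis range_from_nat_into)
    then have "\<forall>i. \<exists>t. c i = ev t" using C(1) unfolding M_def by blast
    then obtain f where f: "\<And>i. c i = ev (f i)" by metis
    have "en C r \<in> M" for r
    proof -
      have "range (tree_eval undefined en \<circ> f) = C"
        using f unfolding c ev_def by auto
      then have "en C r = ev (Node f r)" unfolding ev_def by simp
      then show ?thesis unfolding M_def by blast
    qed
    then show ?thesis using en[OF C(2)] by blast
  qed
  ultimately show ?thesis by (rule that)
qed

section \<open>A caliber theorem\<close>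

text \<open>Maximal convex cones of functions not containing \<open>-1\<close> play the role of finitely additive
  probability measures on \<open>K\<close>: membership of \<open>1\<^sub>F - \<epsilon>\<close> says that \<open>F\<close> has measure at least \<open>\<epsilon>\<close>.\<close>

definition fun_cone :: "'k set \<Rightarrow> ('k \<Rightarrow> real) set \<Rightarrow> bool" where
  "fun_cone K C \<longleftrightarrow> (\<forall>\<phi>. (\<forall>k\<in>K. 0 \<le> \<phi> k) \<longrightarrow> \<phi> \<in> C) \<and>
     (\<forall>\<phi>\<in>C. \<forall>\<psi>\<in>C. (\<lambda>k. \<phi> k + \<psi> k) \<in> C) \<and> (\<forall>\<phi>\<in>C. \<forall>t\<ge>0. (\<lambda>k. t * \<phi> k) \<in> C)"

lemma fun_cone_nonneg: "fun_cone K C \<Longrightarrow> (\<And>k. k \<in> K \<Longrightarrow> 0 \<le> \<phi> k) \<Longrightarrow> \<phi> \<in> C"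
  and fun_cone_add: "fun_cone K C \<Longrightarrow> \<phi> \<in> C \<Longrightarrow> \<psi> \<in> C \<Longrightarrow> (\<lambda>k. \<phi> k + \<psi> k) \<in> C"
  and fun_cone_scale: "fun_cone K C \<Longrightarrow> \<phi> \<in> C \<Longrightarrow> 0 \<le> t \<Longrightarrow> (\<lambda>k. t * \<phi> k) \<in> C"
  unfolding fun_cone_def by blast+

lemma fun_cone_mono:
  assumes "fun_cone K C" "\<phi> \<in> C" "\<And>k. k \<in> K \<Longrightarrow> \<phi> k \<le> \<psi> k"
  shows "\<psi> \<in> C"
proof -
  have "(\<lambda>k. \<psi> k - \<phi> k) \<in> C" using assms by (intro fun_cone_nonneg) auto
  from fun_cone_add[OF assms(1,2) this] show ?thesis by simp
qed

lemma fun_cone_sum: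
  assumes "fun_cone K C" "finite I" "\<And>i. i \<in> I \<Longrightarrow> \<phi> i \<in> C"
  shows "(\<lambda>k. \<Sum>i\<in>I. \<phi> i k) \<in> C"
  using assms(2,3)
proof (induction I)
  case empty
  then show ?case using fun_cone_nonneg[OF assms(1)] by simp
next
  case (insert x F)
  then show ?case using fun_cone_add[OF assms(1)] by simp
qed

lemma fun_cone_const:
  assumes "fun_cone K C" "(\<lambda>_. -1) \<notin> C" "(\<lambda>_. c) \<in> C"
  shows "0 \<le> c"
proof (rule ccontr)
  assume "\<not> 0 \<le> c"
  then have "(\<lambda>_. (1 / - c) * c) \<in> C"
    by (intro fun_cone_scale[OF assms(1,3)]) auto
  with \<open>\<not> 0 \<le> c\<close> assms(2) show False by simp
qed

text \<open>Zorn's lemma in the role of Hahn-Banach. If \<phi> is outside a maximal cone, adjoining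
  it produces -1 = c + t \<phi> with c in the cone and t > 0; dividing by t gives s = 1 / t. In
  terms of integrals, every function is either nonnegative or bounded away from 0 on the negative
  side.\<close>

lemma maximal_cone:
  fixes K :: "'k set"
  assumes "fun_cone K C0" "(\<lambda>_. -1) \<notin> C0"
  obtains C where "C0 \<subseteq> C" "fun_cone K C" "(\<lambda>_. -1) \<notin> C"
    "\<And>\<phi>. \<phi> \<notin> C \<Longrightarrow> \<exists>s>0. (\<lambda>k. - \<phi> k - s) \<in> C"
proof -
  define \<A> where "\<A> = {C. C0 \<subseteq> C \<and> fun_cone K C \<and> (\<lambda>_. -1) \<notin> C}"
  have "C0 \<in> \<A>" using assms unfolding \<A>_def by blast
  moreover have "\<Union>\<C> \<in> \<A>" if ne: "\<C> \<noteq> {}" and ch: "subset.chain \<A> \<C>" for \<C>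
  proof -
    have sub: "\<And>C. C \<in> \<C> \<Longrightarrow> C0 \<subseteq> C \<and> fun_cone K C \<and> (\<lambda>_. -1) \<notin> C"
      using ch unfolding subset.chain_def \<A>_def by blast
    have tot: "\<And>C D. C \<in> \<C> \<Longrightarrow> D \<in> \<C> \<Longrightarrow> C \<subseteq> D \<or> D \<subseteq> C"
      using ch unfolding subset_chain_def by blast
    have "(\<lambda>k. \<phi> k + \<psi> k) \<in> \<Union>\<C>" if "\<phi> \<in> \<Union>\<C>" "\<psi> \<in> \<Union>\<C>" for \<phi> \<psi>
    proof -
      obtain C where "C \<in> \<C>" "\<phi> \<in> C" "\<psi> \<in> C" using \<open>\<phi> \<in> \<Union>\<C>\<close> \<open>\<psi> \<in> \<Union>\<C>\<close> tot by blast
      then show ?thesis using sub fun_cone_add by blast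
    qed
    moreover have "(\<lambda>k. t * \<phi> k) \<in> \<Union>\<C>" if "\<phi> \<in> \<Union>\<C>" "0 \<le> t" for \<phi> t
      using that sub fun_cone_scale by blast
    moreover have "\<phi> \<in> \<Union>\<C>" if "\<forall>k\<in>K. 0 \<le> \<phi> k" for \<phi>
      using that sub fun_cone_nonneg ne by (metis UnionI ex_in_conv)
    ultimately have "fun_cone K (\<Union>\<C>)" unfolding fun_cone_def by blast
    then show ?thesis using sub ne unfolding \<A>_def by blast
  qed
  ultimately obtain C where C: "C \<in> \<A>" "\<And>D. D \<in> \<A> \<Longrightarrow> C \<subseteq> D \<Longrightarrow> D = C"
    using subset_Zorn_nonempty[of \<A>] by blast
  then have cone: "fun_cone K C" and C0: "C0 \<subseteq> C" and m1: "(\<lambda>_. -1) \<notin> C"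
    unfolding \<A>_def by auto
  have "\<exists>s>0. (\<lambda>k. - \<phi> k - s) \<in> C" if "\<phi> \<notin> C" for \<phi>
  proof -
    define D where "D = {\<lambda>k. c k + t * \<phi> k |c t. c \<in> C \<and> 0 \<le> t}"
    have CD: "C \<subseteq> D"
    proof
      fix c assume "c \<in> C"
      then have "(\<lambda>k. c k + 0 * \<phi> k) \<in> D" unfolding D_def by blast
      then show "c \<in> D" by simp
    qed
    have "\<phi> \<in> D"
    proof -
      have "(\<lambda>_. 0) \<in> C" using cone by (intro fun_cone_nonneg) auto
      then have "(\<lambda>k. (\<lambda>_. 0) k + 1 * \<phi> k) \<in> D" unfolding D_def by (intro CollectI exI conjI) auto
      then show ?thesis by simp
    qed
    have "fun_cone K D"
      unfolding fun_cone_def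
    proof (intro conjI allI impI ballI)
      fix \<psi> :: "'k \<Rightarrow> real" assume "\<forall>k\<in>K. 0 \<le> \<psi> k"
      then show "\<psi> \<in> D" using CD cone fun_cone_nonneg by blast
    next
      fix a b assume "a \<in> D" "b \<in> D"
      then obtain c t d u where *: "a = (\<lambda>k. c k + t * \<phi> k)" "c \<in> C" "0 \<le> t"
        "b = (\<lambda>k. d k + u * \<phi> k)" "d \<in> C" "0 \<le> u" unfolding D_def by blast
      have "(\<lambda>k. a k + b k) = (\<lambda>k. (c k + d k) + (t + u) * \<phi> k)"
        unfolding * by (auto simp: algebra_simps)
      then show "(\<lambda>k. a k + b k) \<in> D"
        unfolding D_def using fun_cone_add[OF cone *(2,5)] *(3,6) by force
    next
      fix a u assume "a \<in> D" "0 \<le> (u::real)"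
      then obtain c t where *: "a = (\<lambda>k. c k + t * \<phi> k)" "c \<in> C" "0 \<le> t"
        unfolding D_def by blast
      have "(\<lambda>k. u * a k) = (\<lambda>k. u * c k + (u * t) * \<phi> k)"
        unfolding * by (auto simp: algebra_simps)
      then show "(\<lambda>k. u * a k) \<in> D"
        unfolding D_def using fun_cone_scale[OF cone *(2) \<open>0 \<le> u\<close>] *(3) \<open>0 \<le> u\<close> by force
    qed
    moreover have "D \<noteq> C" using \<open>\<phi> \<in> D\<close> that by blast
    ultimately have "(\<lambda>_. -1) \<in> D" using C(2)[of D] CD C0 unfolding \<A>_def by blast
    then obtain c t where ct: "(\<lambda>_. -1) = (\<lambda>k. c k + t * \<phi> k)" "c \<in> C" "0 \<le> t"
      unfolding D_def by blast
    have "t \<noteq> 0" using ct m1 by auto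
    have "(\<lambda>k. (1 / t) * c k) \<in> C" using ct(2,3) by (intro fun_cone_scale[OF cone]) auto
    moreover have "(1 / t) * c k = - \<phi> k - 1 / t" for k
    proof -
      have "c k = - 1 - t * \<phi> k" using fun_cong[OF ct(1), of k] by linarith
      then show ?thesis using \<open>t \<noteq> 0\<close> by (simp add: field_simps)
    qed
    ultimately show ?thesis using ct(3) \<open>t \<noteq> 0\<close>
      by (intro exI[of _ "1 / t"]) auto
  qed
  then show ?thesis by (rule that[OF C0 cone m1]) 
qed

text \<open>This is a form of the theorem that \<open>c\<^sup>+\<close> is a caliber of every space carrying a
  strictly positive measure. The hypothesis makes the cone generated by all \<open>1\<^sub>E\<^sub>x - \<delta>\<close> proper; the
  finite sets of positive measure with respect to a maximal extension form a ccc poset. If all centered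
  sets were small, a small \<open>M\<close> closed under \<open>\<A> \<mapsto> Y \<A>\<close> for countable \<open>\<A>\<close> would exist, where
  \<open>Y \<A>\<close> is a maximal centered set of points incompatible with \<open>\<A>\<close>. For \<open>x \<in> S - M\<close> and a maximal
  antichain \<open>\<A>\<close> of conditions in \<open>M\<close> incompatible with \<open>x\<close>, the set \<open>Y \<A> \<union> {x}\<close> is again
  centered, contradicting maximality.\<close>

lemma large_centered_subfamily:
  fixes E :: "'a \<Rightarrow> 'k set" and \<delta> :: real
  assumes "0 < \<delta>" and "\<not> small S"
    and dens: "\<And>F h. finite F \<Longrightarrow> F \<subseteq> S \<Longrightarrow> (\<And>x. 0 \<le> h x) \<Longrightarrow>
      \<exists>k\<in>K. \<delta> * (\<Sum>x\<in>F. h x) \<le> (\<Sum>x\<in>F. h x * indicator (E x) k)"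
  obtains Y where "Y \<subseteq> S" "\<not> small Y"
    "\<And>F. finite F \<Longrightarrow> F \<subseteq> Y \<Longrightarrow> \<exists>k\<in>K. \<forall>x\<in>F. k \<in> E x"
proof -
  \<comment> \<open>The weights vanish off \<open>F\<close> so that two sums can be merged over the
    union of their index sets.\<close>
  define C0 :: "('k \<Rightarrow> real) set" where "C0 = {\<phi>. \<exists>F h. finite F \<and> F \<subseteq> S \<and> (\<forall>x. 0 \<le> h x) \<and>
      (\<forall>x. x \<notin> F \<longrightarrow> h x = 0) \<and> (\<forall>k\<in>K. (\<Sum>x\<in>F. h x * (indicator (E x) k - \<delta>)) \<le> \<phi> k)}"
  have "fun_cone K C0"
    unfolding fun_cone_def
  proof (intro conjI allI impI ballI)
    fix \<phi> :: "'k \<Rightarrow> real" assume "\<forall>k\<in>K. 0 \<le> \<phi> k"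
    then show "\<phi> \<in> C0" unfolding C0_def
      by (intro CollectI exI[of _ "{}"] exI[of _ "\<lambda>_. 0"]) auto
  next
    fix \<phi> \<psi> assume "\<phi> \<in> C0" "\<psi> \<in> C0"
    then obtain F h G g where *: "finite F" "F \<subseteq> S" "\<forall>x. 0 \<le> h x" "\<forall>x. x \<notin> F \<longrightarrow> h x = 0"
      "\<forall>k\<in>K. (\<Sum>x\<in>F. h x * (indicator (E x) k - \<delta>)) \<le> \<phi> k"
      "finite G" "G \<subseteq> S" "\<forall>x. 0 \<le> g x" "\<forall>x. x \<notin> G \<longrightarrow> g x = 0"
      "\<forall>k\<in>K. (\<Sum>x\<in>G. g x * (indicator (E x) k - \<delta>)) \<le> \<psi> k"
      unfolding C0_def by blast
    have "(\<Sum>x\<in>F \<union> G. (h x + g x) * (indicator (E x) k - \<delta>)) \<le> \<phi> k + \<psi> k" if "k \<in> K" for k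
    proof -
      have "(\<Sum>x\<in>F \<union> G. (h x + g x) * (indicator (E x) k - \<delta>))
          = (\<Sum>x\<in>F \<union> G. h x * (indicator (E x) k - \<delta>)) + (\<Sum>x\<in>F \<union> G. g x * (indicator (E x) k - \<delta>))"
        by (simp add: sum.distrib[symmetric] distrib_right)
      also have "(\<Sum>x\<in>F \<union> G. h x * (indicator (E x) k - \<delta>)) = (\<Sum>x\<in>F. h x * (indicator (E x) k - \<delta>))"
        using * by (intro sum.mono_neutral_right) auto
      also have "(\<Sum>x\<in>F \<union> G. g x * (indicator (E x) k - \<delta>)) = (\<Sum>x\<in>G. g x * (indicator (E x) k - \<delta>))"
        using * by (intro sum.mono_neutral_right) auto
      finally show ?thesis using *(5,10) that by fastforce
    qed
    then show "(\<lambda>k. \<phi> k + \<psi> k) \<in> C0" unfolding C0_def using *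
      by (intro CollectI exI[of _ "F \<union> G"] exI[of _ "\<lambda>x. h x + g x"]) auto
  next
    fix \<phi> :: "'k \<Rightarrow> real" and t :: real assume "\<phi> \<in> C0" "0 \<le> t"
    then obtain F h where *: "finite F" "F \<subseteq> S" "\<forall>x. 0 \<le> h x" "\<forall>x. x \<notin> F \<longrightarrow> h x = 0"
      "\<forall>k\<in>K. (\<Sum>x\<in>F. h x * (indicator (E x) k - \<delta>)) \<le> \<phi> k"
      unfolding C0_def by blast
    have "(\<Sum>x\<in>F. (t * h x) * (indicator (E x) k - \<delta>)) \<le> t * \<phi> k" if "k \<in> K" for k
      using mult_left_mono[OF *(5)[rule_format, OF that] \<open>0 \<le> t\<close>]
      by (simp add: sum_distrib_left mult.assoc)
    then show "(\<lambda>k. t * \<phi> k) \<in> C0" unfolding C0_def using * \<open>0 \<le> t\<close>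
      by (intro CollectI exI[of _ F] exI[of _ "\<lambda>x. t * h x"]) auto
  qed
  moreover have "(\<lambda>_. -1) \<notin> C0"
  proof
    assume "(\<lambda>_. -1) \<in> C0"
    then obtain F h where *: "finite F" "F \<subseteq> S" "\<forall>x. 0 \<le> h x"
      "\<forall>k\<in>K. (\<Sum>x\<in>F. h x * (indicator (E x) k - \<delta>)) \<le> -1"
      unfolding C0_def by blast
    from dens[OF *(1,2)] *(3) obtain k where "k \<in> K"
      "\<delta> * (\<Sum>x\<in>F. h x) \<le> (\<Sum>x\<in>F. h x * indicator (E x) k)" by blast
    moreover have "(\<Sum>x\<in>F. h x * (indicator (E x) k - \<delta>))
        = (\<Sum>x\<in>F. h x * indicator (E x) k) - \<delta> * (\<Sum>x\<in>F. h x)"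
      by (simp add: right_diff_distrib sum_subtractf sum_distrib_right mult.commute[of \<delta>])
    ultimately show False using *(4) by force
  qed
  ultimately obtain C where C0: "C0 \<subseteq> C" and cone: "fun_cone K C" and m1: "(\<lambda>_. -1) \<notin> C"
    and max: "\<And>\<phi>. \<phi> \<notin> C \<Longrightarrow> \<exists>s>0. (\<lambda>k. - \<phi> k - s) \<in> C"
    using maximal_cone[of K C0] by metis
  define ind :: "'a set \<Rightarrow> 'k \<Rightarrow> real" where "ind F = indicator {k. \<forall>x\<in>F. k \<in> E x}" for F
  have ind01: "0 \<le> ind F k" "ind F k \<le> 1" for F k
    unfolding ind_def by (auto simp: indicator_def)
  have ind_Un: "ind (F \<union> G) k = ind F k * ind G k" for F G k
    unfolding ind_def by (auto simp: indicator_def)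
  define cond where "cond F \<longleftrightarrow> (\<exists>\<epsilon>>0. (\<lambda>k. ind F k - \<epsilon>) \<in> C)" for F
  have cond_mono: "cond F" if "cond G" "F \<subseteq> G" for F G
  proof -
    from \<open>cond G\<close> obtain \<epsilon> where "\<epsilon> > 0" "(\<lambda>k. ind G k - \<epsilon>) \<in> C" unfolding cond_def by blast
    moreover have "(\<lambda>k. ind F k - \<epsilon>) \<in> C"
      using \<open>F \<subseteq> G\<close> by (intro fun_cone_mono[OF cone \<open>(\<lambda>k. ind G k - \<epsilon>) \<in> C\<close>])
        (auto simp: ind_def indicator_def)
    ultimately show ?thesis unfolding cond_def by blast
  qed
  have cond_singleton: "cond {x}" if "x \<in> S" for x
  proof -
    have "(\<lambda>k. ind {x} k - \<delta>) \<in> C0"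
      unfolding C0_def using that
      by (intro CollectI exI[of _ "{x}"] exI[of _ "\<lambda>y. if y = x then 1 else 0"])
        (auto simp: ind_def)
    then show ?thesis using C0 \<open>0 < \<delta>\<close> unfolding cond_def by blast
  qed
  have cond_witness: "\<exists>k\<in>K. \<forall>x\<in>F. k \<in> E x" if cF: "cond F" for F
  proof (rule ccontr)
    assume no: "\<not> ?thesis"
    obtain \<epsilon> where \<epsilon>: "\<epsilon> > 0" "(\<lambda>k. ind F k - \<epsilon>) \<in> C" using cF unfolding cond_def by blast
    have "(\<lambda>_. -\<epsilon>) \<in> C"
      using no by (intro fun_cone_mono[OF cone \<epsilon>(2)]) (auto simp: ind_def)
    with fun_cone_const[OF cone m1] \<epsilon>(1) show False by fastforce
  qed
  \<comment> \<open>Maximality turns the absence of any positive lower bound into every positive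
    upper bound \<open>s\<close>: such an intersection behaves like a null set.\<close>
  have not_cond: "(\<lambda>k. s - ind F k) \<in> C" if "\<not> cond F" "0 < s" for F s
  proof -
    have "(\<lambda>k. ind F k - s) \<notin> C" using that unfolding cond_def by blast
    from max[OF this] obtain r where "r > 0" "(\<lambda>k. - (ind F k - s) - r) \<in> C" by blast
    then show ?thesis by (intro fun_cone_mono[OF cone \<open>(\<lambda>k. - (ind F k - s) - r) \<in> C\<close>]) auto
  qed
  have ccc: "countable \<A>"
    if pos: "\<And>F. F \<in> \<A> \<Longrightarrow> cond F"
      and anti: "\<And>F G. F \<in> \<A> \<Longrightarrow> G \<in> \<A> \<Longrightarrow> F \<noteq> G \<Longrightarrow> \<not> cond (F \<union> G)" for \<A>
  proof -
    \<comment> \<open>Level \<open>m\<close> collects the conditions of measure at least 1 / (m +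
      1). Their pairwise intersections are null, so at most m + 1 of them fit.\<close>
    define \<B> where "\<B> m = {F \<in> \<A>. (\<lambda>k. ind F k - 1 / real (Suc m)) \<in> C}" for m
    have fin: "finite (\<B> m)" for m
    proof (rule finite_if_finite_subsets_card_bdd[THEN conjunct1, rule_format])
      fix B assume B: "B \<subseteq> \<B> m" "finite B"
      define N where "N = real (card B)"
      define \<epsilon> where "\<epsilon> = 1 / real (Suc m)"
      \<comment> \<open>Obtained by adding the lower bounds \<epsilon> over \<open>B\<close> and the
        upper bounds \<open>s\<close> over the off-diagonal pairs; letting \<open>s\<close> tend to
        0 leaves \<open>N * \<epsilon> \<le> 1\<close>.\<close>
      have main: "N * \<epsilon> \<le> 1 + N\<^sup>2 * s" if "s > 0" for s
      proof -
        have "(\<lambda>k. \<Sum>F\<in>B. ind F k - \<epsilon>) \<in> C"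
          using B unfolding \<B>_def \<epsilon>_def by (intro fun_cone_sum[OF cone]) auto
        moreover have "(\<lambda>k. \<Sum>F\<in>B. \<Sum>G\<in>B - {F}. s - ind (F \<union> G) k) \<in> C"
          using B anti \<open>s > 0\<close> unfolding \<B>_def
          by (intro fun_cone_sum[OF cone] not_cond) auto
        ultimately have "(\<lambda>k. (\<Sum>F\<in>B. ind F k - \<epsilon>) + (\<Sum>F\<in>B. \<Sum>G\<in>B - {F}. s - ind (F \<union> G) k)) \<in> C"
          by (rule fun_cone_add[OF cone])
        then have "(\<lambda>k. 1 - N * \<epsilon> + N\<^sup>2 * s) \<in> C"
        proof (rule fun_cone_mono[OF cone])
          fix k
          \<comment> \<open>Bonferroni: with \<open>t\<close> sets containing \<open>k\<close>, \<open>t - t (t - 1) \<le> 1\<close>.\<close>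
          define t where "t = (\<Sum>F\<in>B. ind F k)"
          have sq: "ind F k * ind F k = ind F k" for F unfolding ind_def by (cases "\<forall>x\<in>F. k \<in> E x") auto
          have "(\<Sum>F\<in>B. \<Sum>G\<in>B - {F}. s - ind (F \<union> G) k)
              = (\<Sum>F\<in>B. (\<Sum>G\<in>B. s - ind F k * ind G k) - (s - ind F k))"
            using B(2) by (intro sum.cong) (auto simp: sum_diff1 ind_Un sq)
          also have "\<dots> = N * (N * s) - t * t - (N * s - t)"
            unfolding t_def N_def
            by (simp add: sum_subtractf sum_product sum_distrib_left[symmetric])
          finally have "(\<Sum>F\<in>B. ind F k - \<epsilon>) + (\<Sum>F\<in>B. \<Sum>G\<in>B - {F}. s - ind (F \<union> G) k)
              = 2 * t - t * t - N * \<epsilon> + N * (N * s) - N * s"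
            unfolding t_def N_def by (simp add: sum_subtractf)
          moreover have "2 * t - t * t \<le> 1"
            using zero_le_square[of "t - 1"] by (simp add: algebra_simps)
          moreover have "0 \<le> N * s" unfolding N_def using \<open>s > 0\<close> by simp
          ultimately show "(\<Sum>F\<in>B. ind F k - \<epsilon>) + (\<Sum>F\<in>B. \<Sum>G\<in>B - {F}. s - ind (F \<union> G) k)
              \<le> 1 - N * \<epsilon> + N\<^sup>2 * s"
            by (simp add: power2_eq_square)
        qed
        from fun_cone_const[OF cone m1 this] show ?thesis by simp
      qed
      have "N * \<epsilon> \<le> 1"
      proof (rule field_le_epsilon)
        fix e :: real assume "0 < e"
        \<comment> \<open>The \<open>+ 1\<close> keeps the denominator positive when
          \<open>B\<close> is empty.\<close>
        have pos: "0 < N\<^sup>2 + 1" by (simp add: add_nonneg_pos)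
        have "N * \<epsilon> \<le> 1 + N\<^sup>2 * (e / (N\<^sup>2 + 1))"
          using \<open>0 < e\<close> pos by (intro main divide_pos_pos)
        also have "N\<^sup>2 * (e / (N\<^sup>2 + 1)) \<le> e"
          using \<open>0 < e\<close> pos by (simp add: pos_divide_le_eq distrib_left mult.commute)
        finally show "N * \<epsilon> \<le> 1 + e" by simp
      qed
      then have "N \<le> real (Suc m)" unfolding \<epsilon>_def by (simp add: field_simps)
      then show "card B \<le> Suc m" unfolding N_def by simp
    qed
    have sub: "\<A> \<subseteq> (\<Union>m. \<B> m)"
    proof
      fix F assume "F \<in> \<A>"
      then obtain \<epsilon> where \<epsilon>: "\<epsilon> > 0" "(\<lambda>k. ind F k - \<epsilon>) \<in> C" using pos unfolding cond_def by blast
      then obtain m where "1 / real (Suc m) < \<epsilon>" using nat_approx_posE by blast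
      then have "(\<lambda>k. ind F k - 1 / real (Suc m)) \<in> C"
        by (intro fun_cone_mono[OF cone \<epsilon>(2)]) simp
      with \<open>F \<in> \<A>\<close> show "F \<in> (\<Union>m. \<B> m)" unfolding \<B>_def by blast
    qed
    show ?thesis
      by (rule countable_subset[OF sub]) (auto intro: countable_finite fin)
  qed
  define centered where "centered Y \<longleftrightarrow> (\<forall>F. finite F \<longrightarrow> F \<subseteq> Y \<longrightarrow> cond F)" for Y
  define cand where "cand \<A> = {y \<in> S. \<forall>a\<in>\<A>. \<not> cond (insert y a)}" for \<A>
  show thesis
  proof (cases "\<exists>Y\<subseteq>S. centered Y \<and> \<not> small Y")
    case True
    then show ?thesis using that cond_witness unfolding centered_def by metis
  next
    case False
    have "\<exists>Y. Y \<subseteq> cand \<A> \<and> centered Y \<and>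
        (\<forall>x. x \<in> cand \<A> \<and> centered (insert x Y) \<longrightarrow> x \<in> Y)" if ne: "cond {}" for \<A>
    proof -
      define \<Y> where "\<Y> = {Y. Y \<subseteq> cand \<A> \<and> centered Y}"
      have "{} \<in> \<Y>" using ne unfolding \<Y>_def centered_def by simp
      moreover have "\<Union>\<C> \<in> \<Y>" if "\<C> \<noteq> {}" "subset.chain \<Y> \<C>" for \<C>
      proof -
        have "cond F" if F: "finite F" "F \<subseteq> \<Union>\<C>" for F
        proof -
          obtain Y where "Y \<in> \<C>" "F \<subseteq> Y"
            using finite_subset_Union_chain[OF F \<open>\<C> \<noteq> {}\<close> \<open>subset.chain \<Y> \<C>\<close>] by blast
          moreover have "centered Y"
            using \<open>subset.chain \<Y> \<C>\<close> \<open>Y \<in> \<C>\<close> unfolding \<Y>_def subset.chain_def by blast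
          ultimately show ?thesis using F(1) unfolding centered_def by blast
        qed
        then show ?thesis
          using \<open>subset.chain \<Y> \<C>\<close> unfolding \<Y>_def centered_def subset.chain_def by blast
      qed
      ultimately obtain Y where "Y \<in> \<Y>" and max: "\<And>Z. Z \<in> \<Y> \<Longrightarrow> Y \<subseteq> Z \<Longrightarrow> Z = Y"
        using subset_Zorn_nonempty[of \<Y>] by blast
      moreover have "x \<in> Y" if "x \<in> cand \<A>" "centered (insert x Y)" for x
      proof -
        have "insert x Y \<in> \<Y>" using that \<open>Y \<in> \<Y>\<close> unfolding \<Y>_def by blast
        then have "insert x Y = Y" using max by blast
        then show ?thesis by blast
      qed
      ultimately show ?thesis unfolding \<Y>_def by blast
    qed
    moreover have "cond {}"
    proof -
      obtain x where "x \<in> S" using \<open>\<not> small S\<close> countable_imp_small[of "{}"] by fastforce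
      then show ?thesis using cond_singleton cond_mono by blast
    qed
    ultimately obtain Y where Y: "\<And>\<A>. Y \<A> \<subseteq> cand \<A>" "\<And>\<A>. centered (Y \<A>)"
      "\<And>\<A> x. x \<in> cand \<A> \<Longrightarrow> centered (insert x (Y \<A>)) \<Longrightarrow> x \<in> Y \<A>"
      by metis
    have smallY: "small (Y \<A>)" for \<A>
      using False Y(1,2) unfolding cand_def by blast
    \<comment> \<open>A countable \<open>C\<close> has countably many finite subsets, hence only
      continuum many families of them, and each family contributes a small set. All antichains
      inside \<open>C\<close> are thus served at once.\<close>
    define W where "W C = (\<Union>\<A>\<in>{\<A>. \<A> \<subseteq> {F. finite F \<and> F \<subseteq> C}}. Y \<A>)" for C
    have "small (W C)" if "countable C" for C
    proof -
      have "countable {F. finite F \<and> F \<subseteq> C}"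
        using countable_Collect_finite_subset[OF that] by (simp add: conj_commute)
      then have "{F. finite F \<and> F \<subseteq> C} = range (from_nat_into {F. finite F \<and> F \<subseteq> C})"
        by (intro range_from_nat_into[symmetric]) auto
      then obtain e :: "nat \<Rightarrow> 'a set" where e: "{F. finite F \<and> F \<subseteq> C} \<subseteq> range e"
        by blast
      have "small {\<A>. \<A> \<subseteq> {F. finite F \<and> F \<subseteq> C}}"
        unfolding small_def
      proof (intro exI subsetI)
        fix \<A> assume "\<A> \<in> {\<A>. \<A> \<subseteq> {F. finite F \<and> F \<subseteq> C}}"
        then have "\<A> \<subseteq> range e" using e by blast
        then have "\<A> = e ` {n. e n \<in> \<A>}" by blast
        then show "\<A> \<in> range (\<lambda>S. e ` S)" by blast
      qed
      then show ?thesis unfolding W_def by (rule small_UN_small) (rule smallY)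
    qed
    then obtain M where M: "small M" "M \<noteq> {}"
      "\<And>C. C \<subseteq> M \<Longrightarrow> countable C \<Longrightarrow> C \<noteq> {} \<Longrightarrow> W C \<subseteq> M"
      using small_closure[of W] by metis
    have YM: "Y \<A> \<subseteq> M" if \<A>: "countable \<A>" "\<And>F. F \<in> \<A> \<Longrightarrow> finite F \<and> F \<subseteq> M" for \<A>
    proof -
      obtain m where "m \<in> M" using M(2) by blast
      \<comment> \<open>The extra point \<open>m\<close> keeps \<open>C\<close> nonempty, as the
        closure property demands, even if no member of \<A> has a point.\<close>
      define C where "C = insert m (\<Union>\<A>)"
      have "countable C" unfolding C_def using countable_UN[of \<A> "\<lambda>F. F"] \<A>
        by (auto intro: countable_finite)
      moreover have "C \<subseteq> M" "C \<noteq> {}" unfolding C_def using \<A> \<open>m \<in> M\<close> by auto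
      ultimately have "W C \<subseteq> M" using M(3) by blast
      moreover have "Y \<A> \<subseteq> W C" unfolding W_def C_def using \<A>(2) by blast
      ultimately show ?thesis by blast
    qed
    obtain x where x: "x \<in> S" "x \<notin> M"
      using \<open>\<not> small S\<close> M(1) small_subset by blast
    define P where "P = {F. finite F \<and> F \<subseteq> M \<and> cond F \<and> \<not> cond (insert x F)}"
    define \<Z> where "\<Z> = {\<A>. \<A> \<subseteq> P \<and> (\<forall>F\<in>\<A>. \<forall>G\<in>\<A>. F \<noteq> G \<longrightarrow> \<not> cond (F \<union> G))}"
    have "\<Union>\<C> \<in> \<Z>" if "subset.chain \<Z> \<C>" for \<C>
    proof -
      have sub: "\<And>\<A>. \<A> \<in> \<C> \<Longrightarrow> \<A> \<in> \<Z>" and tot: "\<And>A B. A \<in> \<C> \<Longrightarrow> B \<in> \<C> \<Longrightarrow> A \<subseteq> B \<or> B \<subseteq> A"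
        using that unfolding subset_chain_def by blast+
      have "\<not> cond (F \<union> G)" if FG: "F \<in> \<Union>\<C>" "G \<in> \<Union>\<C>" "F \<noteq> G" for F G
      proof -
        obtain \<A> where "\<A> \<in> \<C>" "F \<in> \<A>" "G \<in> \<A>" using FG(1,2) tot by blast
        then show ?thesis using sub \<open>F \<noteq> G\<close> unfolding \<Z>_def by blast
      qed
      then show ?thesis using sub unfolding \<Z>_def by blast
    qed
    then obtain \<A> where \<A>: "\<A> \<in> \<Z>" "\<And>\<B>. \<B> \<in> \<Z> \<Longrightarrow> \<A> \<subseteq> \<B> \<Longrightarrow> \<B> = \<A>"
      using subset_Zorn'[of \<Z>] by blast
    have "countable \<A>"
      using \<A>(1) unfolding \<Z>_def P_def by (intro ccc) auto
    then have "Y \<A> \<subseteq> M" using \<A>(1) unfolding \<Z>_def P_def by (intro YM) auto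
    have "x \<in> cand \<A>" using x \<A>(1) unfolding cand_def \<Z>_def P_def by blast
    moreover have "centered (insert x (Y \<A>))"
    proof -
      \<comment> \<open>A failing \<open>F\<close> would itself belong to \<open>P\<close>, so by
        maximality of \<A> it would be compatible with some \<open>a\<close> in \<A>. But every
        point of \<open>F\<close> lies in \<open>cand \<A>\<close> and is incompatible with
        \<open>a\<close>; only the empty \<open>F\<close> escapes this, and there
        \<open>cond {x}\<close> suffices.\<close>
      have key: "cond (insert x F)" if F: "finite F" "F \<subseteq> Y \<A>" for F
      proof (rule ccontr)
        assume nc: "\<not> cond (insert x F)"
        have "cond F" using Y(2) F unfolding centered_def by blast
        then have "F \<in> P" unfolding P_def using F nc \<open>Y \<A> \<subseteq> M\<close> by blast
        have "\<exists>a\<in>\<A>. cond (F \<union> a)"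
        proof (rule ccontr)
          assume no: "\<not> ?thesis"
          then have "insert F \<A> \<in> \<Z>"
            using \<A>(1) \<open>F \<in> P\<close> unfolding \<Z>_def by (auto simp: Un_commute)
          then have "F \<in> \<A>" using \<A>(2) by blast
          with no \<open>cond F\<close> show False by force
        qed
        then obtain a where a: "a \<in> \<A>" "cond (F \<union> a)" by blast
        show False
        proof (cases "F = {}")
          case True
          then show False using nc cond_singleton x by simp
        next
          case False
          then obtain y where "y \<in> F" by blast
          then have "\<not> cond (insert y a)" using Y(1) F(2) a(1) unfolding cand_def by blast
          moreover have "insert y a \<subseteq> F \<union> a" using \<open>y \<in> F\<close> by blast
          ultimately show False using a(2) cond_mono by blast
        qed
      qed
      have "cond F" if "finite F" "F \<subseteq> insert x (Y \<A>)" for F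
      proof -
        have "cond (insert x (F - {x}))" using that by (intro key) auto
        then show ?thesis by (rule cond_mono) auto
      qed
      then show ?thesis unfolding centered_def by blast
    qed
    ultimately have "x \<in> Y \<A>" by (rule Y(3))
    with \<open>Y \<A> \<subseteq> M\<close> x(2) show ?thesis by blast
  qed
qed

section \<open>The space with one non-isolated point and its function group\<close>

definition cosmall_topology :: "'a \<Rightarrow> 'a topology" where
  "cosmall_topology p = topology (\<lambda>U. p \<in> U \<longrightarrow> small (- U))"

lemma openin_cosmall: "openin (cosmall_topology p) U \<longleftrightarrow> (p \<in> U \<longrightarrow> small (- U))"
proof -
  have "istopology (\<lambda>U. p \<in> U \<longrightarrow> small (- U))"
    unfolding istopology_def
  proof (intro conjI allI impI)
    fix S T :: "'a set"
    assume "p \<in> S \<longrightarrow> small (- S)" "p \<in> T \<longrightarrow> small (- T)" "p \<in> S \<inter> T"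
    then show "small (- (S \<inter> T))" by (simp add: Compl_Int small_Un)
  next
    fix \<K> :: "'a set set" assume *: "\<forall>K\<in>\<K>. p \<in> K \<longrightarrow> small (- K)" "p \<in> \<Union>\<K>"
    then obtain K where "K \<in> \<K>" "p \<in> K" by blast
    then show "small (- \<Union>\<K>)" using * by (auto intro: small_subset[of "- K"])
  qed
  then show ?thesis unfolding cosmall_topology_def by (simp add: topology_inverse')
qed

lemma topspace_cosmall [simp]: "topspace (cosmall_topology p) = UNIV"
  unfolding topspace_def
  by (auto simp: openin_cosmall intro!: exI[of _ UNIV] countable_imp_small)

lemma closedin_cosmall: "closedin (cosmall_topology p) U \<longleftrightarrow> (p \<notin> U \<longrightarrow> small U)"
  by (simp add: closedin_def openin_cosmall Compl_eq_Diff_UNIV[symmetric])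

lemma zero_dimensional_cosmall: "zero_dimensional (cosmall_topology p)"
  unfolding zero_dimensional_def
proof (intro allI impI)
  fix U x assume *: "openin (cosmall_topology p) U \<and> x \<in> U"
  show "\<exists>V. openin (cosmall_topology p) V \<and> closedin (cosmall_topology p) V \<and> x \<in> V \<and> V \<subseteq> U"
  proof (cases "x = p")
    case True
    then show ?thesis using * by (intro exI[of _ U]) (auto simp: openin_cosmall closedin_cosmall)
  next
    case False
    then show ?thesis using *
      by (intro exI[of _ "{x}"]) (auto simp: openin_cosmall closedin_cosmall intro: countable_imp_small)
  qed
qed

lemma tikhonov_cosmall: "tikhonov_space (cosmall_topology p)"
  unfolding tikhonov_space_def
proof
  have "cosmall_topology p dim_le 0"
    unfolding dimension_le_0_neighbourhood_base_of_clopen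
    using zero_dimensional_cosmall[of p, unfolded zero_dimensional_def]
    by (subst open_neighbourhood_base_of) (auto, blast)
  then show "completely_regular_space (cosmall_topology p)"
    by (rule zero_dimensional_imp_completely_regular_space)
  show "Hausdorff_space (cosmall_topology p)"
    unfolding Hausdorff_space_def
  proof (intro allI impI)
    fix x y assume *: "x \<in> topspace (cosmall_topology p) \<and> y \<in> topspace (cosmall_topology p) \<and> x \<noteq> y"
    \<comment> \<open>Whichever of the two points differs from \<open>p\<close> is isolated, and its
      clopen singleton separates them.\<close>
    define z where "z = (if x = p then y else x)"
    have z: "openin (cosmall_topology p) {z}" "openin (cosmall_topology p) (- {z})"
      using * by (auto simp: z_def openin_cosmall intro: countable_imp_small)
    show "\<exists>U V. openin (cosmall_topology p) U \<and> openin (cosmall_topology p) V \<and>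
        x \<in> U \<and> y \<in> V \<and> disjnt U V"
    proof (cases "z = x")
      case True
      then show ?thesis using z * by (intro exI[of _ "{z}"] exI[of _ "- {z}"]) (auto simp: disjnt_def)
    next
      case False
      then have "z = y" by (auto simp: z_def split: if_splits)
      then show ?thesis using z * by (intro exI[of _ "- {z}"] exI[of _ "{z}"]) (auto simp: disjnt_def)
    qed
  qed
qed

lemma nondiscrete_cosmall:
  assumes "\<not> small (UNIV :: 'a set)"
  shows "cosmall_topology (p :: 'a) \<noteq> discrete_topology (topspace (cosmall_topology p))"
proof
  assume "cosmall_topology p = discrete_topology (topspace (cosmall_topology p))"
  then have "openin (cosmall_topology p) {p}" by (metis UNIV_I openin_discrete_topology subset_UNIV topspace_cosmall)
  then have "small (- {p})" by (simp add: openin_cosmall)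
  then have "small (- {p} \<union> {p})" by (intro small_Un) (auto intro: countable_imp_small)
  moreover have "- {p} \<union> {p} = UNIV" by blast
  ultimately show False using assms by simp
qed

section \<open>The function group in concrete form\<close>

definition cts :: "'a \<Rightarrow> ('a \<Rightarrow> int) set" where
  "cts p = {f. small {x. f x \<noteq> f p}}"

lemma ctsD: "f \<in> cts p \<Longrightarrow> small {x. f x \<noteq> f p}"
  and ctsI: "small {x. f x \<noteq> f p} \<Longrightarrow> f \<in> cts p"
  unfolding cts_def by auto

text \<open>Continuity is automatic away from \<open>p\<close>; at \<open>p\<close> the preimage of
  the single value \<open>f p\<close> decides, because the integers are discrete.\<close>

lemma continuous_map_cosmall:
  "continuous_map (cosmall_topology p) (euclidean :: int topology) f \<longleftrightarrow> f \<in> cts p"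
proof
  assume "continuous_map (cosmall_topology p) (euclidean :: int topology) f"
  from openin_continuous_map_preimage[OF this, of "{f p}"]
  have "openin (cosmall_topology p) {x. f x = f p}" by (simp add: open_discrete)
  then show "f \<in> cts p" by (simp add: openin_cosmall cts_def Compl_eq_Diff_UNIV set_diff_eq)
next
  assume "f \<in> cts p"
  then have "p \<in> {x. f x \<in> U} \<longrightarrow> small (- {x. f x \<in> U})" for U
    by (auto intro: small_subset[OF ctsD[OF \<open>f \<in> cts p\<close>]])
  then show "continuous_map (cosmall_topology p) (euclidean :: int topology) f"
    unfolding continuous_map by (auto simp: openin_cosmall)
qed

lemma cts_const [simp]: "(\<lambda>_. k) \<in> cts p"
  by (intro ctsI countable_imp_small) simp

lemma cts_add [simp]: "f \<in> cts p \<Longrightarrow> g \<in> cts p \<Longrightarrow> (\<lambda>x. f x + g x) \<in> cts p"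
  by (rule ctsI, rule small_subset[OF small_Un[OF ctsD[of f p] ctsD[of g p]]]) auto

lemma cts_uminus [simp]: "f \<in> cts p \<Longrightarrow> (\<lambda>x. - f x) \<in> cts p"
  by (rule ctsI, rule small_subset[OF ctsD]) auto

lemma cts_diff [simp]: "f \<in> cts p \<Longrightarrow> g \<in> cts p \<Longrightarrow> (\<lambda>x. f x - g x) \<in> cts p"
  by (rule ctsI, rule small_subset[OF small_Un[OF ctsD[of f p] ctsD[of g p]]]) auto

lemma cts_scale [simp]: "f \<in> cts p \<Longrightarrow> (\<lambda>x. k * f x) \<in> cts p"
  by (rule ctsI, rule small_subset[OF ctsD]) auto

lemma cts_small_support: "small A \<Longrightarrow> (\<And>x. x \<notin> A \<Longrightarrow> f x = 0) \<Longrightarrow> p \<notin> A \<Longrightarrow> f \<in> cts p"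
  by (rule ctsI, erule small_subset) auto

abbreviation bump :: "'a \<Rightarrow> 'a \<Rightarrow> int" where
  "bump x \<equiv> (\<lambda>y. if y = x then 1 else 0)"

lemma cts_bump [simp]: "x \<noteq> p \<Longrightarrow> bump x \<in> cts p"
  by (rule cts_small_support[of "{x}"]) (auto intro: countable_imp_small)

abbreviation cgrp :: "'a \<Rightarrow> ('a \<Rightarrow> int) topgroup" where
  "cgrp p \<equiv> Cp_int (cosmall_topology p)"

text \<open>Every element of the type is a point of the space, so the restrictions disappear and the
  product topology becomes that of the function type. From here on the type class notions of
  openness, compactness and continuity apply.\<close>

lemma cgrp_simps [simp]:
  "carrier (cgrp p) = cts p"
  "mult (cgrp p) = (\<lambda>f g x. f x + g x)"
  "one (cgrp p) = (\<lambda>x. 0)"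
  "gtop (cgrp p) = top_of_set (cts p)"
  unfolding Cp_int_def by (simp_all add: continuous_map_cosmall euclidean_product_topology restrict_UNIV)

lemma continuous_on_coordinate: "continuous_on S (\<lambda>f. f x)"
  by (rule continuous_on_subset[OF continuous_on_product_coordinates]) simp

lemma comm_group_cgrp: "comm_group (cgrp p)"
proof (rule comm_groupI)
  fix f assume "f \<in> carrier (cgrp p)"
  then show "\<exists>g\<in>carrier (cgrp p). mult (cgrp p) g f = one (cgrp p)"
    by (intro bexI[of _ "\<lambda>x. - f x"]) auto
qed (auto simp: add_ac)

lemma top_ab_group_cgrp: "top_ab_group (cgrp p)"
proof -
  interpret comm_group "cgrp p" by (rule comm_group_cgrp)
  have inv: "m_inv (cgrp p) f = (\<lambda>x. - f x)" if "f \<in> cts p" for f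
    by (rule inv_equality) (use that in auto)
  have 1: "continuous_on (cts p \<times> cts p) (\<lambda>(f, g). \<lambda>x. f x + g x :: int)"
    unfolding case_prod_beta
    by (intro continuous_on_coordinatewise_then_product continuous_on_add
        continuous_on_product_then_coordinatewise[OF continuous_on_fst]
        continuous_on_product_then_coordinatewise[OF continuous_on_snd] continuous_on_id)
  have neg: "continuous_on (cts p) (\<lambda>f. - f x :: int)" for x
    by (rule continuous_on_compose2[OF Topological_Spaces.continuous_on_discrete[of UNIV uminus]
          continuous_on_coordinate]) simp
  have 2: "continuous_on (cts p) (\<lambda>f x. - f x :: int)"
    by (intro continuous_on_coordinatewise_then_product neg)
  have "continuous_map (top_of_set (cts p)) (top_of_set (cts p)) (\<lambda>f. m_inv (cgrp p) f)"
    by (rule continuous_map_eq[of _ _ "\<lambda>f x. - f x"])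
      (use 2 inv in \<open>auto simp: continuous_map_in_subtopology\<close>)
  moreover have "continuous_map (prod_topology (top_of_set (cts p)) (top_of_set (cts p)))
      (top_of_set (cts p)) (\<lambda>(f, g). mult (cgrp p) f g)"
    using 1 by (auto simp: continuous_map_in_subtopology simp flip: subtopology_Times)
  ultimately show ?thesis unfolding top_ab_group_def using comm_group_cgrp by simp
qed

section \<open>The circle and the characters of the function group\<close>

lemma circle_simps [simp]:
  "carrier circle_group = sphere 0 1"
  "mult circle_group = (*)"
  "gtop circle_group = top_of_set (sphere 0 1)"
  unfolding circle_group_def by simp_all

lemma cis_Arg_unit: "norm z = 1 \<Longrightarrow> cis (Arg z) = z"
  by (metis cis_Arg norm_zero sgn_eq zero_neq_one div_by_1 of_real_1)

text \<open>The circle has no small subgroups: the powers of a nontrivial element cannot all stay in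
  the open right half-plane.\<close>

lemma unit_circle_no_small_powers:
  assumes "norm z = 1" and pos: "\<And>k::nat. 0 < Re (z ^ k)"
  shows "z = 1"
proof (rule ccontr)
  assume "z \<noteq> 1"
  define a where "a = Arg z"
  have z: "z = cis a" unfolding a_def by (simp add: cis_Arg_unit assms(1))
  with \<open>z \<noteq> 1\<close> have "a \<noteq> 0" by auto
  have a: "- pi < a" "a \<le> pi" unfolding a_def using Arg_bounded by auto
  have "0 < cos a" using pos[of 1] unfolding z by simp
  have "\<bar>a\<bar> < pi / 2"
  proof (rule ccontr)
    assume "\<not> \<bar>a\<bar> < pi / 2"
    then have "cos \<bar>a\<bar> \<le> 0" using a cos_monotone_0_pi_le[of "pi/2" "\<bar>a\<bar>"] by auto
    with \<open>0 < cos a\<close> show False by simp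
  qed
  \<comment> \<open>The first multiple of \<open>\<bar>a\<bar>\<close> that reaches pi / 2. It
    overshoots by less than \<open>\<bar>a\<bar>\<close>, hence stays below pi, where the cosine is
    not positive.\<close>
  define k where "k = nat \<lceil>(pi / 2) / \<bar>a\<bar>\<rceil>"
  have "(pi / 2) / \<bar>a\<bar> \<le> real k" "real k < (pi / 2) / \<bar>a\<bar> + 1"
    unfolding k_def using \<open>a \<noteq> 0\<close> of_int_ceiling_le_add_one[of "(pi / 2) / \<bar>a\<bar>"]
      ceiling_correct[of "(pi / 2) / \<bar>a\<bar>"]
    by (auto simp: real_nat_ceiling_ge of_nat_nat)
  then have k: "pi / 2 \<le> real k * \<bar>a\<bar>" "real k * \<bar>a\<bar> < pi / 2 + \<bar>a\<bar>"
    using \<open>a \<noteq> 0\<close> by (simp_all add: field_simps)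
  have "cos (real k * \<bar>a\<bar>) \<le> 0"
    using k \<open>\<bar>a\<bar> < pi / 2\<close> cos_monotone_0_pi_le[of "pi/2" "real k * \<bar>a\<bar>"] by auto
  moreover have "cos (real k * \<bar>a\<bar>) = cos (real k * a)"
    by (cases "0 \<le> a") (auto simp: abs_if)
  moreover have "0 < cos (real k * a)" using pos[of k] unfolding z by (simp add: Complex.DeMoivre)
  ultimately show False by simp
qed

lemma cis_mult_int: "cis t = 1 \<Longrightarrow> cis (t * of_int k) = 1"
proof -
  assume "cis t = 1"
  then have "cos t = 1" by (metis cis.sel(1) one_complex.sel(1))
  then obtain n :: int where "t = of_int n * 2 * pi"
    unfolding cos_one_2pi_int by blast
  then have "t * of_int k = 2 * pi * of_int (n * k)" by simp
  then show ?thesis by (metis Ints_of_int cis_multiple_2pi)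
qed

lemma cis_sum: "finite F \<Longrightarrow> cis (\<Sum>x\<in>F. h x) = (\<Prod>x\<in>F. cis (h x))"
  by (induction F rule: finite_induct) (auto simp: cis_mult[symmetric])

lemma charactersD:
  assumes "c \<in> characters (cgrp p)"
  shows "\<And>f. f \<in> cts p \<Longrightarrow> norm (c f) = 1"
    and "\<And>f g. f \<in> cts p \<Longrightarrow> g \<in> cts p \<Longrightarrow> c (\<lambda>x. f x + g x) = c f * c g"
    and "continuous_on (cts p) c"
    and "c \<in> extensional (cts p)"
proof -
  have h: "c \<in> hom (cgrp p) circle_group" and
    "continuous_map (top_of_set (cts p)) (top_of_set (sphere 0 1)) c" "c \<in> extensional (cts p)"
    using assms unfolding characters_def by auto
  then show "continuous_on (cts p) c" "c \<in> extensional (cts p)"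
    by (auto simp: continuous_map_in_subtopology)
  show "norm (c f) = 1" if "f \<in> cts p" for f
    using h that unfolding hom_def by auto
  show "c (\<lambda>x. f x + g x) = c f * c g" if "f \<in> cts p" "g \<in> cts p" for f g
    using hom_mult[OF h, of f g] that by simp
qed

lemma charactersI:
  assumes "\<And>f. f \<in> cts p \<Longrightarrow> norm (c f) = 1"
    and "\<And>f g. f \<in> cts p \<Longrightarrow> g \<in> cts p \<Longrightarrow> c (\<lambda>x. f x + g x) = c f * c g"
    and "continuous_on (cts p) c"
    and "c \<in> extensional (cts p)"
  shows "c \<in> characters (cgrp p)"
  using assms unfolding characters_def hom_def by (auto simp: continuous_map_in_subtopology)

lemma character_zero: "c \<in> characters (cgrp p) \<Longrightarrow> c (\<lambda>x. 0) = 1"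
  using charactersD(1,2)[of c p "\<lambda>x. 0" ] charactersD(2)[of c p "\<lambda>x. 0" "\<lambda>x. 0"]
  by (metis add_0 cts_const mult_cancel_left1 norm_zero zero_neq_one)

lemma character_scale:
  assumes c: "c \<in> characters (cgrp p)" and f: "f \<in> cts p" and t: "c f = cis t"
  shows "c (\<lambda>x. k * f x) = cis (t * of_int k)"
proof (induction k rule: int_induct[where k = 0])
  case base
  then show ?case using character_zero[OF c] by simp
next
  case (step1 i)
  have "c (\<lambda>x. i * f x + f x) = cis (t * of_int i) * cis t"
    using charactersD(2)[OF c, of "\<lambda>x. i * f x" f] f step1 t by simp
  then show ?case by (simp add: algebra_simps cis_mult)
next
  case (step2 i)
  have "c (\<lambda>x. (i - 1) * f x + f x) = c (\<lambda>x. (i - 1) * f x) * cis t"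
    using charactersD(2)[OF c, of "\<lambda>x. (i - 1) * f x" f] f t by simp
  moreover have "(\<lambda>x. (i - 1) * f x + f x) = (\<lambda>x. i * f x)" by (auto simp: algebra_simps)
  ultimately have "c (\<lambda>x. (i - 1) * f x) * cis t = cis (t * of_int i)" using step2 by simp
  then have "c (\<lambda>x. (i - 1) * f x) * (cis t * cis (- t)) = cis (t * of_int i) * cis (- t)"
    by (simp add: mult.assoc[symmetric])
  then show ?case by (simp add: cis_mult algebra_simps)
qed

lemma open_fun_cylinder:
  fixes W :: "('a \<Rightarrow> 'b::topological_space) set"
  assumes "open W" "f \<in> W"
  obtains F where "finite F" "\<And>g. (\<And>x. x \<in> F \<Longrightarrow> g x = f x) \<Longrightarrow> g \<in> W"
proof -
  from product_topology_open_contains_basis[OF assms(1)[unfolded open_fun_def] assms(2)]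
  obtain V where V: "f \<in> PiE UNIV V" "finite {i. V i \<noteq> UNIV}" "PiE UNIV V \<subseteq> W"
    by auto
  show ?thesis
  proof (rule that[OF V(2)])
    fix g assume g: "\<And>x. x \<in> {i. V i \<noteq> UNIV} \<Longrightarrow> g x = f x"
    have "g x \<in> V x" for x
    proof (cases "V x = UNIV")
      case False
      then show ?thesis using g[of x] V(1) by (auto simp: PiE_iff)
    qed simp
    then show "g \<in> W" using V(3) by (auto simp: PiE_iff)
  qed
qed

text \<open>A neighbourhood of 0 contains all functions that vanish on some finite \<open>F\<close>.
  They form a subgroup, so its image is a subgroup of the circle inside the right half-plane, hence
  trivial.\<close>

lemma character_finite_support:
  assumes c: "c \<in> characters (cgrp p)"
  obtains F where "finite F" "\<And>f. f \<in> cts p \<Longrightarrow> (\<And>x. x \<in> F \<Longrightarrow> f x = 0) \<Longrightarrow> c f = 1"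
proof -
  have "open {z. 0 < Re z}" by (simp add: open_halfspace_Re_gt)
  then obtain W where W: "open W" "W \<inter> cts p = c -` {z. 0 < Re z} \<inter> cts p"
    using charactersD(3)[OF c] unfolding continuous_on_open_invariant by metis
  have "(\<lambda>x. 0) \<in> W" using W(2) character_zero[OF c] cts_const[of 0 p] by fastforce
  then obtain F where F: "finite F" "\<And>g. (\<And>x. x \<in> F \<Longrightarrow> g x = 0) \<Longrightarrow> g \<in> W"
    using open_fun_cylinder[OF W(1)] by metis
  show ?thesis
  proof (rule that[OF F(1)])
    fix f assume f: "f \<in> cts p" "\<And>x. x \<in> F \<Longrightarrow> f x = 0"
    obtain t where t: "c f = cis t" using charactersD(1)[OF c f(1)] by (metis cis_Arg_unit)
    have "0 < Re (c f ^ k)" for k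
    proof -
      have "(\<lambda>x. int k * f x) \<in> W" using f F(2) by simp
      then have "0 < Re (c (\<lambda>x. int k * f x))" using W(2) f by auto
      then show ?thesis using character_scale[OF c f(1) t, of "int k"] t
        by (simp add: Complex.DeMoivre mult.commute)
    qed
    then show "c f = 1" using unit_circle_no_small_powers charactersD(1)[OF c f(1)] by blast
  qed
qed

text \<open>Angles are real numbers, not classes modulo 2 pi. A character then has many codes, but
  one-parameter subgroups of the dual are available.\<close>

definition chi :: "'a \<Rightarrow> 'a set \<Rightarrow> ('a \<Rightarrow> real) \<Rightarrow> ('a \<Rightarrow> int) \<Rightarrow> complex" where
  "chi p F \<theta> = (\<lambda>f\<in>cts p. cis (\<Sum>x\<in>F. \<theta> x * of_int (f x)))"

lemma chi_apply [simp]: "f \<in> cts p \<Longrightarrow> chi p F \<theta> f = cis (\<Sum>x\<in>F. \<theta> x * of_int (f x))"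
  by (simp add: chi_def)

lemma chi_character: "chi p F \<theta> \<in> characters (cgrp p)"
proof (rule charactersI)
  have "continuous_on (cts p) (\<lambda>f. cis (\<Sum>x\<in>F. \<theta> x * of_int (f x)))"
    by (intro continuous_on_cis continuous_on_sum continuous_on_mult continuous_on_const
        continuous_on_of_int continuous_on_coordinate)
  then show "continuous_on (cts p) (chi p F \<theta>)"
    by (rule continuous_on_eq) simp
qed (auto simp: chi_def cis_mult sum.distrib algebra_simps)

text \<open>On \<open>F\<close> and at \<open>p\<close> a function \<open>f\<close> agrees with
  \<open>f p\<close> plus the sum of \<open>(f x - f p) * bump x\<close> over the isolated points
  \<open>x\<close> of \<open>F\<close>. The constant 1 has to stand in for \<open>bump p\<close>,
  which need not be continuous.\<close>

lemma character_eq_chi: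
  assumes c: "c \<in> characters (cgrp p)"
  obtains F \<theta> where "finite F" "c = chi p F \<theta>"
proof -
  obtain F where F: "finite F" "\<And>f. f \<in> cts p \<Longrightarrow> (\<And>x. x \<in> F \<Longrightarrow> f x = 0) \<Longrightarrow> c f = 1"
    using character_finite_support[OF c] by metis
  obtain t where t: "c (\<lambda>_. 1) = cis t"
    using charactersD(1)[OF c, of "\<lambda>_. 1"] by (metis cis_Arg_unit cts_const)
  have "\<exists>s. x \<noteq> p \<longrightarrow> c (bump x) = cis s" for x
    using charactersD(1)[OF c cts_bump, of x] by (metis cis_Arg_unit)
  then obtain s where s: "\<And>x. x \<noteq> p \<Longrightarrow> c (bump x) = cis (s x)" by metis
  have main: "(\<lambda>y. k + (\<Sum>x\<in>A. h x * bump x y)) \<in> cts p \<and>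
      c (\<lambda>y. k + (\<Sum>x\<in>A. h x * bump x y)) = cis (t * of_int k + (\<Sum>x\<in>A. s x * of_int (h x)))"
    if "finite A" "p \<notin> A" for A k h
    using that
  proof (induction A rule: finite_induct)
    case empty
    then show ?case using character_scale[OF c _ t, of k] by simp
  next
    case (insert a A)
    let ?g = "\<lambda>y. k + (\<Sum>x\<in>A. h x * bump x y)"
    have "c (\<lambda>y. h a * bump a y) = cis (s a * of_int (h a))"
      using insert by (intro character_scale[OF c]) (auto simp: s)
    moreover have "(\<lambda>y. h a * bump a y) \<in> cts p"
      using insert by (intro cts_scale cts_bump) auto
    moreover have "(\<lambda>y. k + (\<Sum>x\<in>insert a A. h x * bump x y)) = (\<lambda>y. ?g y + h a * bump a y)"
      using insert by (simp add: algebra_simps)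
    moreover have "?g \<in> cts p" "c ?g = cis (t * of_int k + (\<Sum>x\<in>A. s x * of_int (h x)))"
      using insert by auto
    ultimately show ?case
      using insert(1,2) charactersD(2)[OF c, of ?g "\<lambda>y. h a * bump a y"]
        cts_add[of ?g p "\<lambda>y. h a * bump a y"]
      by (auto simp: cis_mult add_ac)
  qed
  define A where "A = F - {p}"
  \<comment> \<open>The constant 1 also takes the value 1 at the points of \<open>A\<close>;
    subtracting their angles corrects the angle at \<open>p\<close>.\<close>
  define \<theta> where "\<theta> x = (if x = p then t - (\<Sum>x\<in>A. s x) else s x)" for x
  have A: "finite A" "p \<notin> A" using F unfolding A_def by auto
  have "c f = chi p (insert p A) \<theta> f" if f: "f \<in> cts p" for f
  proof -
    let ?g = "\<lambda>y. f p + (\<Sum>x\<in>A. (f x - f p) * bump x y)"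
    have g: "?g \<in> cts p" "c ?g = cis (t * of_int (f p) + (\<Sum>x\<in>A. s x * of_int (f x - f p)))"
      using main[OF A, of "f p" "\<lambda>x. f x - f p"] by auto
    have "f y - ?g y = 0" if "y \<in> F" for y
    proof (cases "y = p")
      case True
      then show ?thesis using A by (auto intro!: sum.neutral)
    next
      case False
      then have "y \<in> A" using that unfolding A_def by simp
      then show ?thesis using A by (simp add: if_distrib sum.delta cong: if_cong)
    qed
    then have "c (\<lambda>y. f y - ?g y) = 1" using f g by (intro F(2)) auto
    moreover have "c (\<lambda>y. (f y - ?g y) + ?g y) = c (\<lambda>y. f y - ?g y) * c ?g"
      using f g by (intro charactersD(2)[OF c] cts_diff)
    ultimately have "c f = c ?g" by simp
    moreover have "(\<Sum>x\<in>insert p A. \<theta> x * of_int (f x))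
        = t * of_int (f p) + (\<Sum>x\<in>A. s x * of_int (f x - f p))"
    proof -
      have "(\<Sum>x\<in>A. \<theta> x * of_int (f x)) = (\<Sum>x\<in>A. s x * of_int (f x))"
        using A by (intro sum.cong) (auto simp: \<theta>_def)
      then show ?thesis using A
        by (simp add: \<theta>_def algebra_simps sum_subtractf sum_distrib_right)
    qed
    ultimately show ?thesis using f g by simp
  qed
  then have "c = chi p (insert p A) \<theta>"
    using charactersD(4)[OF c] by (intro extensionalityI[of _ "cts p"]) (auto simp: chi_def)
  then show ?thesis using that A by blast
qed

section \<open>Dual and bidual group\<close>

text \<open>Near 0 the values lie in the right half-plane, where square roots are unique. Halving
  therefore determines \<open>r\<close> at all points \<eta> / 2^k, hence at their integer
  multiples, and these are dense.\<close>

lemma real_character: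
  fixes r :: "real \<Rightarrow> complex"
  assumes cont: "continuous_on UNIV r" and norm: "\<And>t. norm (r t) = 1"
    and add: "\<And>s t. r (s + t) = r s * r t"
  obtains b where "\<And>t. r t = cis (b * t)"
proof -
  have r0: "r 0 = 1" using add[of 0 0] norm[of 0] by (metis add_0 mult_cancel_left1 norm_zero zero_neq_one)
  have "isCont r 0" using cont by (simp add: continuous_on_eq_continuous_at)
  then obtain d where d: "d > 0" "\<And>t. \<bar>t\<bar> < d \<Longrightarrow> dist (r t) 1 < 1"
    unfolding continuous_at_eps_delta using r0 by (metis dist_real_def diff_zero zero_less_one)
  define \<eta> where "\<eta> = d / 2"
  have "\<eta> > 0" unfolding \<eta>_def using d by simp
  have pos: "0 < Re (r t)" if "\<bar>t\<bar> \<le> \<eta>" for t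
  proof -
    have "dist (r t) 1 < 1" using that d unfolding \<eta>_def by (intro d(2)) linarith
    then have "\<bar>Re (r t - 1)\<bar> < 1" using abs_Re_le_cmod[of "r t - 1"] by (simp add: dist_norm)
    then show ?thesis by simp
  qed
  define a where "a = Arg (r \<eta>)"
  have a: "r \<eta> = cis a" unfolding a_def by (simp add: cis_Arg_unit norm)
  have "\<bar>a\<bar> \<le> pi / 2"
  proof (rule ccontr)
    assume *: "\<not> \<bar>a\<bar> \<le> pi / 2"
    have "\<bar>a\<bar> \<le> pi" unfolding a_def using Arg_bounded[of "r \<eta>"] by auto
    then have "cos \<bar>a\<bar> \<le> 0" using * cos_monotone_0_pi_le[of "pi/2" "\<bar>a\<bar>"] by auto
    moreover have "0 < cos a" using pos[of \<eta>] \<open>\<eta> > 0\<close> a by simp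
    ultimately show False by simp
  qed
  have half: "r (\<eta> / 2 ^ k) = cis (a / 2 ^ k)" for k :: nat
  proof (induction k)
    case 0
    then show ?case using a by simp
  next
    case (Suc k)
    let ?z = "r (\<eta> / 2 ^ Suc k)" and ?w = "cis (a / 2 ^ Suc k)"
    have "?z * ?z = ?w * ?w"
      using add[of "\<eta> / 2 ^ Suc k" "\<eta> / 2 ^ Suc k"] Suc by (simp add: cis_mult field_simps)
    then have "(?z - ?w) * (?z + ?w) = 0" by (simp add: algebra_simps)
    then have "?z = ?w \<or> ?z = - ?w" by (simp add: eq_neg_iff_add_eq_0)
    moreover have "0 < Re ?z"
    proof (rule pos)
      have "(1::real) \<le> 2 ^ Suc k" by (rule one_le_power) simp
      then show "\<bar>\<eta> / 2 ^ Suc k\<bar> \<le> \<eta>"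
        using \<open>\<eta> > 0\<close> mult_left_mono[of 1 "2 ^ Suc k" \<eta>] by (simp add: divide_le_eq)
    qed
    moreover have "0 \<le> Re ?w"
    proof -
      have "(1::real) \<le> 2 ^ Suc k" by (rule one_le_power) simp
      then have "\<bar>a\<bar> / 2 ^ Suc k \<le> \<bar>a\<bar>"
        using mult_left_mono[of 1 "2 ^ Suc k" "\<bar>a\<bar>"] by (simp add: divide_le_eq)
      then have "\<bar>a / 2 ^ Suc k\<bar> \<le> pi / 2" using \<open>\<bar>a\<bar> \<le> pi / 2\<close> by simp
      then have "0 \<le> cos (a / 2 ^ Suc k)" by (intro cos_ge_zero) linarith+
      then show ?thesis by simp
    qed
    ultimately show ?case by auto
  qed
  define u where "u t = r t * cis (- (a / \<eta>) * t)" for t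
  have u_add: "u (s + t) = u s * u t" for s t
    unfolding u_def add distrib_left cis_mult[symmetric] by (simp add: mult_ac)
  have u_half: "u (\<eta> / 2 ^ k) = 1" for k
    unfolding u_def half using \<open>\<eta> > 0\<close> by (simp add: cis_mult)
  have u0: "u 0 = 1" unfolding u_def using r0 by simp
  have u_nat: "u (real m * (\<eta> / 2 ^ k)) = 1" for m k
    by (induction m) (simp_all add: u0 distrib_right u_add u_half del: times_divide_eq_right)
  have u_neg: "u (- t) * u t = 1" for t using u_add[of "- t" t] u0 by simp
  have u_int: "u (of_int m * (\<eta> / 2 ^ k)) = 1" for m k
  proof (cases "0 \<le> m")
    case True
    then show ?thesis using u_nat[of "nat m" k] by simp
  next
    case False
    then show ?thesis using u_nat[of "nat (- m)" k] u_neg[of "real (nat (- m)) * (\<eta> / 2 ^ k)"] by simp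
  qed
  have u1: "u t = 1" for t
  proof -
    \<comment> \<open>The remainder of \<open>t\<close> modulo \<eta> / 2^k. It tends to 0, while
      \<open>u\<close> takes the same value at it as at \<open>t\<close>.\<close>
    define s where "s k = t - of_int \<lfloor>t / (\<eta> / 2 ^ k)\<rfloor> * (\<eta> / 2 ^ k)" for k :: nat
    have s: "\<bar>s k\<bar> \<le> \<eta> * (1 / 2) ^ k" for k
    proof -
      have p: "\<eta> / 2 ^ k > 0" using \<open>\<eta> > 0\<close> by simp
      have "t - of_int \<lfloor>t / q\<rfloor> * q = frac (t / q) * q" if "q > 0" for q
        using that by (simp add: frac_def left_diff_distrib)
      from this[OF p] have "s k = frac (t / (\<eta> / 2 ^ k)) * (\<eta> / 2 ^ k)" unfolding s_def .
      moreover have "0 \<le> frac (t / (\<eta> / 2 ^ k))" "frac (t / (\<eta> / 2 ^ k)) \<le> 1"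
        using frac_lt_1 frac_ge_0 less_imp_le by blast+
      ultimately have "0 \<le> s k" "s k \<le> 1 * (\<eta> / 2 ^ k)"
        using p mult_right_mono[of "frac (t / (\<eta> / 2 ^ k))" 1 "\<eta> / 2 ^ k"]
          mult_nonneg_nonneg[of "frac (t / (\<eta> / 2 ^ k))" "\<eta> / 2 ^ k"] by (metis less_imp_le)+
      then show ?thesis by (simp add: power_divide)
    qed
    have "(\<lambda>k. \<eta> * (1 / 2) ^ k) \<longlonglongrightarrow> \<eta> * 0"
      by (intro tendsto_mult tendsto_const LIMSEQ_realpow_zero) auto
    then have "s \<longlonglongrightarrow> 0" using s by (intro Lim_null_comparison[of s]) auto
    moreover have "continuous_on UNIV u" unfolding u_def by (intro continuous_intros cont)
    ultimately have "(\<lambda>k. u (s k)) \<longlonglongrightarrow> u 0"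
      by (intro isCont_tendsto_compose[of 0 u]) (simp_all add: continuous_on_eq_continuous_at)
    moreover have "u (s k) = u t" for k
      using u_add[of "s k" "of_int \<lfloor>t / (\<eta> / 2 ^ k)\<rfloor> * (\<eta> / 2 ^ k)"] u_int
      by (simp add: s_def)
    ultimately show ?thesis using u0 by (simp add: LIMSEQ_const_iff)
  qed
  show ?thesis
  proof (rule that)
    fix t
    have "r t * (cis (- (a / \<eta>) * t) * cis ((a / \<eta>) * t)) = cis ((a / \<eta>) * t)"
      using u1[of t] unfolding u_def by (simp add: mult.assoc[symmetric])
    then show "r t = cis ((a / \<eta>) * t)" by (simp add: cis_mult)
  qed
qed

lemma circle_character:
  fixes r :: "real \<Rightarrow> complex"
  assumes "continuous_on UNIV r" "\<And>t. norm (r t) = 1" "\<And>s t. r (s + t) = r s * r t"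
    and "r (2 * pi) = 1"
  obtains n :: int where "\<And>t. r t = cis (t * of_int n)"
proof -
  obtain b where b: "\<And>t. r t = cis (b * t)" using real_character[OF assms(1-3)] by metis
  have "cos (b * (2 * pi)) = 1" using assms(4) unfolding b by (metis cis.sel(1) one_complex.sel(1))
  then obtain n :: int where "b * (2 * pi) = of_int n * 2 * pi" unfolding cos_one_2pi_int by blast
  then have "b = of_int n" by simp
  then show ?thesis using that b by (metis mult.commute)
qed

section \<open>The compact-open dual and its characters\<close>

lemma dual_simps [simp]:
  "carrier (dual_group G) = characters G"
  "mult (dual_group G) = (\<lambda>c d. \<lambda>x\<in>carrier G. c x * d x)"
  "topspace (gtop (dual_group G)) = characters G"
proof -
  have "\<exists>K U. characters G = {c \<in> characters G. c ` K \<subseteq> U} \<and>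
      compactin (gtop G) K \<and> openin (gtop circle_group) U"
    by (intro exI[of _ "{}"]) auto
  then show "topspace (gtop (dual_group G)) = characters G"
    unfolding dual_group_def by (simp, blast)
qed (simp_all add: dual_group_def)

lemma openin_dual_basic:
  "compactin (gtop G) K \<Longrightarrow> openin (gtop circle_group) U \<Longrightarrow>
    openin (gtop (dual_group G)) {c \<in> characters G. c ` K \<subseteq> U}"
  unfolding dual_group_def by (simp, intro topology_generated_by_Basis) blast

lemma continuous_map_into_dual:
  assumes "\<And>x. x \<in> topspace X \<Longrightarrow> F x \<in> characters G"
    and "\<And>K U. compactin (gtop G) K \<Longrightarrow> openin (gtop circle_group) U \<Longrightarrow>
      openin X {x \<in> topspace X. F x ` K \<subseteq> U}"
  shows "continuous_map X (gtop (dual_group G)) F"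
proof -
  have eq: "F -` {c \<in> characters G. c ` K \<subseteq> U} \<inter> topspace X = {x \<in> topspace X. F x ` K \<subseteq> U}" for K U
    using assms(1) by auto
  have "F ` topspace X \<subseteq> topspace (gtop (dual_group G))" using assms(1) by auto
  then show ?thesis
    unfolding dual_group_def using assms(2)
    by (auto simp: continuous_on_generated_topo_iff eq simp del: vimage_Collect_eq)
qed

lemma compactin_cgrp [simp]: "compactin (top_of_set (cts p)) K \<longleftrightarrow> compact K \<and> K \<subseteq> cts p"
  by (auto simp: compactin_subtopology)

lemma finite_coordinate_values:
  fixes K :: "('a \<Rightarrow> int) set"
  assumes "compact K"
  shows "finite ((\<lambda>f. f x) ` K)"
proof -
  have "compact ((\<lambda>f. f x) ` K)"
    using assms by (intro compact_continuous_image continuous_on_coordinate)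
  then obtain D where D: "D \<subseteq> UNIV" "finite D" "(\<lambda>f. f x) ` K \<subseteq> (\<Union>c\<in>D. {c})"
    by (rule compactE_image[where C = UNIV and f = "\<lambda>c. {c}"]) (auto simp: open_discrete)
  then show ?thesis by (auto intro: finite_subset)
qed

text \<open>On a compact set the coordinate \<open>x\<close> takes finitely many values, so a
  subbasic neighbourhood imposes only finitely many open conditions on \<open>t\<close>.\<close>

lemma continuous_map_chi_line:
  "continuous_map euclidean (gtop (dual_group (cgrp p))) (\<lambda>t. chi p {x} (\<lambda>_. t))"
proof (rule continuous_map_into_dual)
  show "chi p {x} (\<lambda>_. t) \<in> characters (cgrp p)" for t by (rule chi_character)
next
  fix K U assume "compactin (gtop (cgrp p)) K" "openin (gtop circle_group) U"
  then have K: "compact K" "K \<subseteq> cts p" and "openin (top_of_set (sphere 0 1)) U" by simp_all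
  then obtain V where V: "open V" "U = sphere 0 1 \<inter> V" by (auto simp: openin_open)
  have "{t \<in> topspace euclidean. chi p {x} (\<lambda>_. t) ` K \<subseteq> U}
      = (\<Inter>k\<in>(\<lambda>f. f x) ` K. {t. cis (t * of_int k) \<in> V})"
    using K(2) V(2) by (fastforce simp: image_subset_iff subset_iff)
  moreover have "open {t. cis (t * of_int k) \<in> V}" for k
    using V(1) by (intro open_vimage[unfolded vimage_def]) (auto intro!: continuous_intros)
  then have "open (\<Inter>k\<in>(\<lambda>f. f x) ` K. {t. cis (t * of_int k) \<in> V})"
    by (intro open_INT finite_coordinate_values[OF K(1)]) blast
  ultimately show "openin euclidean {t \<in> topspace euclidean. chi p {x} (\<lambda>_. t) ` K \<subseteq> U}"
    by (simp only: open_openin[symmetric])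
qed

lemma dual_charactersD:
  assumes "\<psi> \<in> characters (dual_group G)"
  shows "\<And>c. c \<in> characters G \<Longrightarrow> norm (\<psi> c) = 1"
    and "\<And>c d. c \<in> characters G \<Longrightarrow> d \<in> characters G \<Longrightarrow>
      \<psi> (\<lambda>x\<in>carrier G. c x * d x) = \<psi> c * \<psi> d"
    and "continuous_map (gtop (dual_group G)) (top_of_set (sphere 0 1)) \<psi>"
    and "\<psi> \<in> extensional (characters G)"
  using assms unfolding characters_def[of "dual_group G"] hom_def by auto

text \<open>Along the line \<open>t\<close> to \<open>chi p {x} (\<lambda>_. t)\<close>, \<psi> is a
  continuous character of the reals with period 2 pi, hence given by an integer, which serves as
  \<open>n x\<close>. Multiplicativity extends this to finitely many coordinates.\<close>

lemma bidual_coordinate: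
  assumes \<psi>: "\<psi> \<in> characters (dual_group (cgrp p))"
  obtains n :: "'a \<Rightarrow> int" where
    "\<And>F \<theta>. finite F \<Longrightarrow> \<psi> (chi p F \<theta>) = cis (\<Sum>x\<in>F. \<theta> x * of_int (n x))"
proof -
  have mult: "\<psi> (chi p F \<theta>) = \<psi> (chi p A \<alpha>) * \<psi> (chi p B \<beta>)"
    if "\<And>f. (\<Sum>x\<in>F. \<theta> x * of_int (f x)) = (\<Sum>x\<in>A. \<alpha> x * of_int (f x)) + (\<Sum>x\<in>B. \<beta> x * of_int (f x))"
    for F \<theta> A \<alpha> B \<beta>
  proof -
    have "chi p F \<theta> = (\<lambda>f\<in>carrier (cgrp p). chi p A \<alpha> f * chi p B \<beta> f)"
      unfolding chi_def using that by (auto simp: cis_mult restrict_def)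
    then show ?thesis using dual_charactersD(2)[OF \<psi> chi_character chi_character] by simp
  qed
  have one: "\<psi> (chi p A \<alpha>) = 1" if "\<And>f. cis (\<Sum>x\<in>A. \<alpha> x * of_int (f x)) = 1" for A \<alpha>
  proof -
    have "chi p A \<alpha> = (\<lambda>f\<in>carrier (cgrp p). chi p A \<alpha> f * chi p A \<alpha> f)"
      unfolding chi_def using that by (auto simp: restrict_def)
    then have "\<psi> (chi p A \<alpha>) = \<psi> (chi p A \<alpha>) * \<psi> (chi p A \<alpha>)"
      using dual_charactersD(2)[OF \<psi> chi_character chi_character] by metis
    moreover have "\<psi> (chi p A \<alpha>) \<noteq> 0"
      using dual_charactersD(1)[OF \<psi> chi_character] by (metis norm_zero zero_neq_one)
    ultimately show ?thesis by simp
  qed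
  have "\<exists>n::int. \<forall>t. \<psi> (chi p {x} (\<lambda>_. t)) = cis (t * of_int n)" for x
  proof -
    let ?r = "\<lambda>t. \<psi> (chi p {x} (\<lambda>_. t))"
    have "continuous_map euclidean (top_of_set (sphere 0 1)) ?r"
      using continuous_map_compose[OF continuous_map_chi_line dual_charactersD(3)[OF \<psi>]]
      by (simp add: o_def)
    then have "continuous_on UNIV ?r" by (auto simp: continuous_map_in_subtopology)
    moreover have "norm (?r t) = 1" for t by (rule dual_charactersD(1)[OF \<psi> chi_character])
    moreover have "?r (s + t) = ?r s * ?r t" for s t
      by (rule mult) (simp add: distrib_right)
    moreover have "?r (2 * pi) = 1"
      using cis_mult_int[of "2 * pi"] cis_multiple_2pi[of 1] by (intro one) simp
    ultimately show ?thesis using circle_character[of ?r] by metis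
  qed
  then obtain n :: "'a \<Rightarrow> int" where n: "\<And>x t. \<psi> (chi p {x} (\<lambda>_. t)) = cis (t * of_int (n x))"
    by metis
  show ?thesis
  proof (rule that)
    fix F :: "'a set" and \<theta> assume "finite F"
    then show "\<psi> (chi p F \<theta>) = cis (\<Sum>x\<in>F. \<theta> x * of_int (n x))"
    proof (induction F rule: finite_induct)
      case empty
      then show ?case using one[where A = "{}"] by simp
    next
      case (insert a F)
      have "\<psi> (chi p (insert a F) \<theta>) = \<psi> (chi p {a} (\<lambda>_. \<theta> a)) * \<psi> (chi p F \<theta>)"
        using insert by (intro mult) simp
      then show ?case using insert n by (simp add: cis_mult)
    qed
  qed
qed

text \<open>The property \<open>nice\<close> survives finite intersections and enlargement, which
  leaves the subbasic sets. There the trivial character places 1 in \<open>U\<close> as soon as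
  \<open>K\<close> is nonempty, and closeness to 1 on \<open>K\<close> suffices.\<close>

lemma dual_nhd_one:
  assumes "openin (gtop (dual_group (cgrp p))) W" "(\<lambda>f\<in>cts p. 1) \<in> W"
  obtains K \<epsilon> where "compact K" "K \<noteq> {}" "K \<subseteq> cts p" "0 < \<epsilon>"
    "\<And>c. c \<in> characters (cgrp p) \<Longrightarrow> (\<And>f. f \<in> K \<Longrightarrow> dist (c f) 1 < \<epsilon>) \<Longrightarrow> c \<in> W"
proof -
  define nice where "nice W \<longleftrightarrow> (\<exists>K \<epsilon>. compact K \<and> K \<subseteq> cts p \<and> 0 < (\<epsilon>::real) \<and>
    (\<forall>c\<in>characters (cgrp p). (\<forall>f\<in>K. dist (c f) 1 < \<epsilon>) \<longrightarrow> c \<in> W))" for W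
  define \<S> where "\<S> = {{c \<in> characters (cgrp p). c ` K \<subseteq> U} | K U.
          compactin (gtop (cgrp p)) K \<and> openin (gtop circle_group) U}"
  have "generate_topology_on \<S> W"
    using assms(1) unfolding dual_group_def \<S>_def by (simp add: openin_topology_generated_by)
  then have "(\<lambda>f\<in>cts p. 1) \<in> W \<longrightarrow> nice W"
  proof (induction W rule: generate_topology_on.induct)
    case Empty
    then show ?case by simp
  next
    case (Int a b)
    show ?case
    proof
      assume "(\<lambda>f\<in>cts p. 1) \<in> a \<inter> b"
      then have "nice a" "nice b" using Int.IH by blast+
      then obtain K \<epsilon> L \<delta> where *: "compact K" "K \<subseteq> cts p" "0 < (\<epsilon>::real)"
        "\<forall>c\<in>characters (cgrp p). (\<forall>f\<in>K. dist (c f) 1 < \<epsilon>) \<longrightarrow> c \<in> a"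
        "compact L" "L \<subseteq> cts p" "0 < (\<delta>::real)"
        "\<forall>c\<in>characters (cgrp p). (\<forall>f\<in>L. dist (c f) 1 < \<delta>) \<longrightarrow> c \<in> b"
        unfolding nice_def by blast
      show "nice (a \<inter> b)"
        unfolding nice_def
        by (intro exI[of _ "K \<union> L"] exI[of _ "min \<epsilon> \<delta>"]) (use * in auto)
    qed
  next
    case (UN K)
    show ?case
    proof
      assume "(\<lambda>f\<in>cts p. 1) \<in> \<Union>K"
      then obtain k where "k \<in> K" "nice k" using UN.IH by blast
      moreover have "nice B" if "nice A" "A \<subseteq> B" for A B
        using that unfolding nice_def by (meson subsetD)
      ultimately show "nice (\<Union>K)" by blast
    qed
  next
    case (Basis s)
    show ?case
    proof
      assume 1: "(\<lambda>f\<in>cts p. 1) \<in> s"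
      obtain K U where s: "s = {c \<in> characters (cgrp p). c ` K \<subseteq> U}" and K: "compact K" "K \<subseteq> cts p"
        and U: "openin (top_of_set (sphere 0 1)) U" using Basis unfolding \<S>_def by auto
      obtain V where V: "open V" "U = sphere 0 1 \<inter> V" using U by (auto simp: openin_open)
      show "nice s"
      proof (cases "K = {}")
        case True
        then show ?thesis unfolding nice_def s by (intro exI[of _ "{}"] exI[of _ 1]) auto
      next
        case False
        then obtain f where "f \<in> K" by blast
        then have "1 \<in> V" using 1 K V unfolding s by force
        then obtain \<epsilon> where "\<epsilon> > 0" "\<And>z. dist z 1 < \<epsilon> \<Longrightarrow> z \<in> V"
          using V(1) unfolding open_dist by metis
        then show ?thesis unfolding nice_def s V(2)
          by (intro exI[of _ K] exI[of _ \<epsilon>]) (use K charactersD(1)[of _ p] in auto)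
      qed
    qed
  qed
  then obtain K \<epsilon> where "compact K" "K \<subseteq> cts p" "0 < (\<epsilon>::real)"
    "\<forall>c\<in>characters (cgrp p). (\<forall>f\<in>K. dist (c f) 1 < \<epsilon>) \<longrightarrow> c \<in> W"
    using assms(2) unfolding nice_def by blast
  \<comment> \<open>The zero function is added to \<open>K\<close> to make it nonempty; this only
    strengthens the demand on \<open>c\<close>.\<close>
  then show ?thesis
    by (intro that[of "insert (\<lambda>x. 0) K" \<epsilon>]) auto
qed

lemma dist_cis: "dist (cis a) (cis b) \<le> \<bar>a - b\<bar>"
proof -
  have "cis a - cis b = cis b * (cis (a - b) - 1)" by (simp add: right_diff_distrib cis_mult)
  then have "dist (cis a) (cis b) = norm (cis (a - b) - 1)"
    by (simp add: dist_norm norm_mult)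
  also have "\<dots> = 2 * \<bar>sin ((a - b) / 2)\<bar>" using dist_exp_i_1[of "a - b"] by (simp add: cis_conv_exp)
  also have "\<dots> \<le> \<bar>a - b\<bar>" using abs_sin_x_le_abs_x[of "(a - b) / 2"] by simp
  finally show ?thesis .
qed

lemma open_coordinate_value: "open {f :: 'a \<Rightarrow> int. f x = k}"
  using open_vimage[OF open_discrete[of "{k}"] continuous_on_coordinate[of UNIV x]]
  by (simp add: vimage_def)

lemma open_coordinate_eq: "open {f :: 'a \<Rightarrow> int. f x = f y}"
proof -
  have "open (\<Union>k. {f :: 'a \<Rightarrow> int. f x = k} \<inter> {f. f y = k})"
    by (intro open_UN open_Int open_coordinate_value ballI)
  moreover have "(\<Union>k. {f :: 'a \<Rightarrow> int. f x = k} \<inter> {f. f y = k}) = {f. f x = f y}" by auto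
  ultimately show ?thesis by metis
qed

text \<open>If \<open>n\<close> were discontinuous, it would differ from \<open>n p\<close> by a constant \<open>v\<close> on a set \<open>S\<close> that is
  not small. Weights \<open>h\<close> on \<open>S\<close> yield the characters
  \<open>f \<mapsto> cis (\<Sum>x. \<pi> h x (f x - f p) / (H v))\<close>, which \<open>\<psi>\<close> sends to \<open>-1\<close>; continuity of \<open>\<psi>\<close> turns this
  into a lower bound for the intersection number of the sets \<open>{f \<in> K. f x \<noteq> f p}\<close>.\<close>

lemma bidual_coordinate_cts:
  assumes \<psi>: "\<psi> \<in> characters (dual_group (cgrp p))"
    and n: "\<And>F \<theta>. finite F \<Longrightarrow> \<psi> (chi p F \<theta>) = cis (\<Sum>x\<in>F. \<theta> x * of_int (n x))"
  shows "n \<in> cts p"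
proof (rule ccontr)
  assume "n \<notin> cts p"
  then have big: "\<not> small {x. n x \<noteq> n p}" by (simp add: cts_def)
  define W where "W = {c \<in> characters (cgrp p). \<psi> c \<in> {z. 0 < Re z}}"
  have "open {z. 0 < Re z}" by (simp add: open_halfspace_Re_gt)
  then have "openin (top_of_set (sphere 0 1)) (sphere 0 1 \<inter> {z. 0 < Re z})" by (rule openin_open_Int)
  from openin_continuous_map_preimage[OF dual_charactersD(3)[OF \<psi>] this]
  have "openin (gtop (dual_group (cgrp p))) W"
    unfolding W_def by (rule back_subst[where P = "openin _"]) (use dual_charactersD(1)[OF \<psi>] in auto)
  moreover have "(\<lambda>f\<in>cts p. 1) \<in> W"
  proof -
    have "(\<lambda>f\<in>cts p. 1) = chi p {} (\<lambda>_. 0)" unfolding chi_def by simp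
    moreover have "chi p {} (\<lambda>_. 0) \<in> W"
      unfolding W_def using n[of "{}" "\<lambda>_. 0"] by (auto simp: chi_character)
    ultimately show ?thesis by simp
  qed
  ultimately obtain K \<epsilon> where K: "compact K" "K \<noteq> {}" "K \<subseteq> cts p" and "0 < \<epsilon>"
    and KW: "\<And>c. c \<in> characters (cgrp p) \<Longrightarrow> (\<And>f. f \<in> K \<Longrightarrow> dist (c f) 1 < \<epsilon>) \<Longrightarrow> c \<in> W"
    using dual_nhd_one[of p W] by metis
  have "\<exists>m::nat. 1 \<le> m \<and> (\<forall>f\<in>K. \<bar>f x - f p\<bar> \<le> int m)" for x
  proof -
    have "finite ((\<lambda>(a, b). \<bar>a - b\<bar>) ` ((\<lambda>f. f x) ` K \<times> (\<lambda>f. f p) ` K))"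
      using finite_coordinate_values[OF K(1)] by blast
    then obtain M where M: "\<And>z. z \<in> (\<lambda>(a, b). \<bar>a - b\<bar>) ` ((\<lambda>f. f x) ` K \<times> (\<lambda>f. f p) ` K) \<Longrightarrow> z \<le> M"
      using bdd_above_finite unfolding bdd_above_def by meson
    have "\<bar>f x - f p\<bar> \<le> M" if "f \<in> K" for f
      using that by (intro M) force
    then show ?thesis by (intro exI[of _ "max 1 (nat M)"]) force
  qed
  then obtain m :: "'a \<Rightarrow> nat" where m: "\<And>x. 1 \<le> m x" "\<And>x f. f \<in> K \<Longrightarrow> \<bar>f x - f p\<bar> \<le> int (m x)"
    by metis
  \<comment> \<open>The pairs of a difference \<open>n x - n p\<close> and a bound
    \<open>m x\<close> are countably many, so some class with nonzero difference is not small. On it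
    both quantities are constant.\<close>
  define T where "T i = {x. n x - n p = fst i \<and> m x = snd i}" for i
  have "\<exists>i. fst i \<noteq> 0 \<and> \<not> small (T i)"
  proof (rule ccontr)
    assume "\<not> ?thesis"
    then have "small (\<Union>i\<in>{i. fst i \<noteq> 0}. T i)"
      by (intro small_UN_small) (auto intro: countable_imp_small)
    then have "small {x. n x \<noteq> n p}" by (rule small_subset) (auto simp: T_def)
    with big show False ..
  qed
  then obtain v M where v: "v \<noteq> 0" and bigT: "\<not> small (T (v, M))" by auto
  define S where "S = T (v, M)"
  have S: "\<And>x. x \<in> S \<Longrightarrow> n x = n p + v" "\<And>x f. x \<in> S \<Longrightarrow> f \<in> K \<Longrightarrow> \<bar>f x - f p\<bar> \<le> int M" "\<And>x. x \<in> S \<Longrightarrow> 1 \<le> M"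
    using m unfolding S_def T_def by auto
  have "S \<noteq> {}" using bigT countable_imp_small[of "{}"] unfolding S_def by auto
  then have "1 \<le> M" using S(3) by blast
  have "p \<notin> S" using S(1)[of p] v by auto
  \<comment> \<open>Read off from the estimate below, in which \<epsilon> is at most pi M / (H |v|)
    times the weight of those \<open>x\<close> with \<open>f x\<close> different from
    \<open>f p\<close>; \<open>H\<close> is the total weight.\<close>
  define \<delta> where "\<delta> = \<epsilon> * \<bar>of_int v\<bar> / (pi * real M)"
  have "0 < \<delta>" unfolding \<delta>_def using \<open>0 < \<epsilon>\<close> v \<open>1 \<le> M\<close> by simp
  define E :: "'a \<Rightarrow> ('a \<Rightarrow> int) set" where "E x = {f. f x \<noteq> f p}" for x
  have dens: "\<exists>f\<in>K. \<delta> * (\<Sum>x\<in>F. h x) \<le> (\<Sum>x\<in>F. h x * indicator (E x) f)"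
    if F: "finite F" "F \<subseteq> S" and h: "\<And>x. 0 \<le> h x" for F and h :: "'a \<Rightarrow> real"
  proof (cases "(\<Sum>x\<in>F. h x) = 0")
    \<comment> \<open>With zero total weight any element of \<open>K\<close> will do, so
      \<open>K\<close> must be nonempty.\<close>
    case True
    moreover have "0 \<le> (\<Sum>x\<in>F. h x * indicator (E x) f)" for f
      by (intro sum_nonneg mult_nonneg_nonneg h) auto
    ultimately show ?thesis using K(2) by auto
  next
    case False
    define H where "H = (\<Sum>x\<in>F. h x)"
    have "0 < H" using False sum_nonneg[of F h] h unfolding H_def by (simp add: less_le)
    have "p \<notin> F" using F(2) \<open>p \<notin> S\<close> by blast
    \<comment> \<open>Scaled so that the numbers \<open>a x * v\<close> add up to pi over
      \<open>F\<close>.\<close>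
    define a where "a x = pi * h x / (H * of_int v)" for x
    define \<theta> where "\<theta> x = (if x = p then - (\<Sum>x\<in>F. a x) else a x)" for x
    define c where "c = chi p (insert p F) \<theta>"
    have eq: "(\<Sum>x\<in>insert p F. \<theta> x * of_int (f x)) = (\<Sum>x\<in>F. a x * of_int (f x - f p))" for f
    proof -
      have "(\<Sum>x\<in>F. \<theta> x * of_int (f x)) = (\<Sum>x\<in>F. a x * of_int (f x))"
        using \<open>p \<notin> F\<close> by (intro sum.cong) (auto simp: \<theta>_def)
      then show ?thesis using F(1) \<open>p \<notin> F\<close>
        by (simp add: \<theta>_def algebra_simps sum_subtractf sum_distrib_right)
    qed
    have "\<psi> c = cis (\<Sum>x\<in>F. a x * of_int (n x - n p))"
      unfolding c_def using n[of "insert p F" \<theta>] F(1) by (simp only: eq finite_insert)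
    also have "(\<Sum>x\<in>F. a x * of_int (n x - n p)) = (\<Sum>x\<in>F. a x * of_int v)"
      using F(2) S(1) by (intro sum.cong) auto
    also have "\<dots> = (\<Sum>x\<in>F. pi * h x / H)" using v unfolding a_def by (intro sum.cong) auto
    also have "\<dots> = pi"
      using \<open>0 < H\<close> by (simp add: sum_divide_distrib[symmetric] sum_distrib_left[symmetric] H_def)
    finally have "c \<notin> W" unfolding W_def by simp
    then obtain f where f: "f \<in> K" "\<epsilon> \<le> dist (c f) 1"
      using KW[of c] chi_character unfolding c_def by (metis not_less)
    have "dist (c f) 1 = dist (cis (\<Sum>x\<in>F. a x * of_int (f x - f p))) (cis 0)"
      unfolding c_def using f(1) K(3) by (simp add: eq[unfolded of_int_diff] subset_iff)
    also have "\<dots> \<le> \<bar>(\<Sum>x\<in>F. a x * of_int (f x - f p)) - 0\<bar>" by (rule dist_cis)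
    also have "\<dots> \<le> (\<Sum>x\<in>F. \<bar>a x * of_int (f x - f p)\<bar>)" by (simp add: sum_abs)
    also have "\<dots> \<le> (\<Sum>x\<in>F. (pi * real M / (H * \<bar>of_int v\<bar>)) * (h x * indicator (E x) f))"
    proof (rule sum_mono)
      fix x assume "x \<in> F"
      have a: "\<bar>a x\<bar> = pi * h x / (H * \<bar>of_int v\<bar>)"
        unfolding a_def using \<open>0 < H\<close> h[of x] by (simp add: abs_mult)
      have "\<bar>of_int (f x - f p)\<bar> \<le> real M * indicator (E x) f"
      proof (cases "f x = f p")
        case False
        have "real_of_int \<bar>f x - f p\<bar> \<le> real_of_int (int M)"
          using S(2)[of x f] F(2) \<open>x \<in> F\<close> f(1) by (subst of_int_le_iff) blast
        then show ?thesis using False unfolding E_def by simp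
      qed simp
      then have "\<bar>a x\<bar> * \<bar>of_int (f x - f p)\<bar> \<le> \<bar>a x\<bar> * (real M * indicator (E x) f)"
        by (intro mult_left_mono) auto
      then show "\<bar>a x * of_int (f x - f p)\<bar> \<le> (pi * real M / (H * \<bar>of_int v\<bar>)) * (h x * indicator (E x) f)"
        unfolding abs_mult a by (simp add: mult_ac)
    qed
    also have "\<dots> = (pi * real M / (H * \<bar>of_int v\<bar>)) * (\<Sum>x\<in>F. h x * indicator (E x) f)"
      by (simp add: sum_distrib_left)
    finally have "\<epsilon> \<le> (pi * real M / (H * \<bar>of_int v\<bar>)) * (\<Sum>x\<in>F. h x * indicator (E x) f)"
      using f(2) by linarith
    then have "\<delta> * H \<le> (\<Sum>x\<in>F. h x * indicator (E x) f)"
      unfolding \<delta>_def using \<open>0 < H\<close> v \<open>1 \<le> M\<close> by (simp add: field_simps)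
    then show ?thesis using f(1) unfolding H_def by blast
  qed
  have "\<exists>Y\<subseteq>S. \<not> small Y \<and> (\<forall>F. finite F \<longrightarrow> F \<subseteq> Y \<longrightarrow> (\<exists>f\<in>K. \<forall>x\<in>F. f \<in> E x))"
  proof (rule large_centered_subfamily[OF \<open>0 < \<delta>\<close> bigT[folded S_def], where K = K and E = E])
    show "\<exists>f\<in>K. \<delta> * (\<Sum>x\<in>F. h x) \<le> (\<Sum>x\<in>F. h x * indicator (E x) f)"
      if "finite F" "F \<subseteq> S" "\<And>x. 0 \<le> h x" for F h
      using that by (rule dens)
  qed blast
  then obtain Y where Y: "Y \<subseteq> S" "\<not> small Y"
    "\<And>F. finite F \<Longrightarrow> F \<subseteq> Y \<Longrightarrow> \<exists>f\<in>K. \<forall>x\<in>F. f \<in> E x"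
    by blast
  have "K \<inter> (\<Inter>x\<in>Y. E x) \<noteq> {}"
  proof (rule compact_imp_fip_image[OF K(1)])
    show "closed (E x)" for x
      unfolding E_def closed_def Collect_neg_eq[symmetric] using open_coordinate_eq[of x p] by simp
    show "K \<inter> (\<Inter>x\<in>F. E x) \<noteq> {}" if "finite F" "F \<subseteq> Y" for F
      using Y(3)[OF that] by blast
  qed
  then obtain f where "f \<in> K" "Y \<subseteq> {x. f x \<noteq> f p}" unfolding E_def by blast
  moreover from this K(3) have "f \<in> cts p" by blast
  ultimately have "small Y" using small_subset[OF ctsD[of f p], of Y] by simp
  with Y(2) show False ..
qed

section \<open>Compact sets of characters\<close>

text \<open>If infinitely many isolated points were charged, the open sets \<open>U d\<close> would
  cover \<open>C\<close> without a finite subcover: finitely many \<open>d\<close> use up finitely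
  many points, and for a remaining \<open>X k\<close> the function \<open>j k\<close> times
  \<open>bump (X k)\<close> lies in each of their boxes, yet \<open>c k\<close> maps it outside the
  right half-plane.\<close>

lemma dual_compact_finite_support:
  assumes "compactin (gtop (dual_group (cgrp p))) C"
  obtains F where "finite F"
    "\<And>c f. c \<in> C \<Longrightarrow> f \<in> cts p \<Longrightarrow> (\<And>x. x \<in> F \<Longrightarrow> f x = 0) \<Longrightarrow> c f = 1"
proof -
  have C: "C \<subseteq> characters (cgrp p)" using compactin_subset_topspace[OF assms] by simp
  define T where "T = {x. x \<noteq> p \<and> (\<exists>c\<in>C. c (bump x) \<noteq> 1)}"
  have "finite T"
  proof (rule ccontr)
    assume "infinite T"
    then obtain X :: "nat \<Rightarrow> 'a" where X: "inj X" "range X \<subseteq> T"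
      using infinite_countable_subset by blast
    have "\<exists>c\<in>C. c (bump (X k)) \<noteq> 1" for k using X(2) unfolding T_def by blast
    then obtain c where c: "\<And>k. c k \<in> C" "\<And>k. c k (bump (X k)) \<noteq> 1" by metis
    have Xp: "X k \<noteq> p" for k using X(2) unfolding T_def by blast
    have "\<exists>j::nat. \<not> 0 < Re (c k (bump (X k)) ^ j)" for k
      using unit_circle_no_small_powers c C charactersD(1)[OF _ cts_bump[OF Xp]] by blast
    then obtain j :: "nat \<Rightarrow> nat" where j: "\<And>k. \<not> 0 < Re (c k (bump (X k)) ^ j k)" by metis
    have "\<exists>F. finite F \<and> (\<forall>f\<in>cts p. (\<forall>x\<in>F. f x = 0) \<longrightarrow> d f = 1)" if "d \<in> C" for d
      using character_finite_support[of d p] that C by (metis subsetD)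
    then obtain F where F: "\<And>d. d \<in> C \<Longrightarrow> finite (F d)"
      "\<And>d f. d \<in> C \<Longrightarrow> f \<in> cts p \<Longrightarrow> (\<forall>x\<in>F d. f x = 0) \<Longrightarrow> d f = 1"
      by metis
    \<comment> \<open>A box over the countable set \<open>range X\<close> with the coordinates in
      \<open>F d\<close> frozen at 0. The character \<open>d\<close> is trivial on it, and at a free
      \<open>X k\<close> it offers the value \<open>j k\<close> that exposes
      \<open>c k\<close>.\<close>
    define B where "B d y = (if y \<in> range X - F d then {0, int (j (inv_into UNIV X y))} else {0})" for d y
    define K where "K d = PiE UNIV (B d)" for d
    define U where "U d = {c \<in> characters (cgrp p). c ` K d \<subseteq> sphere 0 1 \<inter> {z. 0 < Re z}}" for d
    have K0: "f \<in> cts p" "\<forall>x\<in>F d. f x = 0" if "f \<in> K d" for f d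
    proof -
      have f: "f y \<in> B d y" for y using that unfolding K_def by (auto simp: PiE_iff)
      have "f y = 0" if "y \<notin> range X" for y using f[of y] that unfolding B_def by auto
      then show "f \<in> cts p" using Xp
        by (intro cts_small_support[of "range X"]) (auto intro: countable_imp_small)
      have "f x = 0" if "x \<in> F d" for x using f[of x] that unfolding B_def by simp
      then show "\<forall>x\<in>F d. f x = 0" by blast
    qed
    have "openin (gtop (dual_group (cgrp p))) (U d)" for d
      unfolding U_def
    proof (rule openin_dual_basic)
      have "compactin (product_topology (\<lambda>_. euclidean) UNIV) (K d)"
        unfolding K_def compactin_PiE B_def by (auto intro: finite_imp_compact)
      then have "compact (K d)" by (simp add: euclidean_product_topology)
      then show "compactin (gtop (cgrp p)) (K d)" using K0(1) by auto
      show "openin (gtop circle_group) (sphere 0 1 \<inter> {z. 0 < Re z})"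
        by (simp add: openin_open_Int open_halfspace_Re_gt)
    qed
    moreover have "d \<in> U d" if "d \<in> C" for d
      unfolding U_def using that C F(2)[OF that] K0 by auto
    ultimately obtain \<F> where \<F>: "finite \<F>" "\<F> \<subseteq> U ` C" "C \<subseteq> \<Union>\<F>"
      using assms unfolding compactin_def
      by (elim conjE allE[of _ "U ` C"]) blast
    then obtain D where D: "D \<subseteq> C" "finite D" "\<F> = U ` D" using finite_subset_image by metis
    have "finite (\<Union>d\<in>D. F d)" using D F(1) by blast
    moreover have "infinite (range X)" using X(1) finite_imageD by blast
    ultimately obtain k where k: "X k \<notin> (\<Union>d\<in>D. F d)" by (metis finite_subset image_subsetI)
    obtain d where d: "d \<in> D" "c k \<in> U d" using c(1)[of k] \<F>(3) D(3) by blast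
    define f where "f = (\<lambda>y. int (j k) * bump (X k) y)"
    have "f y \<in> B d y" for y
      using k d(1) X(1) unfolding f_def B_def by auto
    then have "f \<in> K d" unfolding K_def by auto
    then have "0 < Re (c k f)" using d(2) unfolding U_def by auto
    moreover have "c k f = c k (bump (X k)) ^ j k"
    proof -
      have ck: "c k \<in> characters (cgrp p)" using c(1) C by blast
      obtain t where t: "c k (bump (X k)) = cis t"
        using charactersD(1)[OF ck cts_bump[OF Xp]] by (metis cis_Arg_unit)
      show ?thesis unfolding f_def
        using character_scale[OF ck cts_bump[OF Xp] t, of "int (j k)"] t
        by (simp add: Complex.DeMoivre mult.commute)
    qed
    ultimately show False using j by simp
  qed
  show ?thesis
  proof (rule that)
    show "finite (insert p T)" using \<open>finite T\<close> by simp
    fix c f assume c: "c \<in> C" and f: "f \<in> cts p" "\<And>x. x \<in> insert p T \<Longrightarrow> f x = 0"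
    obtain A \<theta> where A: "finite A" "c = chi p A \<theta>" using character_eq_chi[of c p] c C by (metis subsetD)
    \<comment> \<open>At \<open>p\<close> and on \<open>T\<close> the function vanishes; at every
      other point the character is trivial on the bump, so its angle there is a multiple of 2
      pi.\<close>
    have "cis (\<theta> x * of_int (f x)) = 1" if "x \<in> A" for x
    proof (cases "x \<in> insert p T")
      case True
      then show ?thesis using f(2) by simp
    next
      case False
      then have "x \<noteq> p" "c (bump x) = 1" using c unfolding T_def by auto
      then have "cis (\<theta> x) = 1" using A that
        by (simp add: if_distrib[of real_of_int] if_distrib[of "(*) _"] cong: if_cong)
      then show ?thesis by (rule cis_mult_int)
    qed
    then show "c f = 1" using A f(1) by (simp add: cis_sum)
  qed
qed

section \<open>The evaluation map\<close>

lemma evaluation_apply: "c \<in> characters G \<Longrightarrow> evaluation G g c = c g"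
  by (simp add: evaluation_def)

lemma evaluation_character:
  assumes g: "g \<in> cts p"
  shows "evaluation (cgrp p) g \<in> characters (dual_group (cgrp p))"
proof -
  let ?D = "dual_group (cgrp p)"
  have mult: "(\<lambda>f\<in>cts p. c f * d f) \<in> characters (cgrp p)"
    if "c \<in> characters (cgrp p)" "d \<in> characters (cgrp p)" for c d
  proof (rule charactersI)
    have "continuous_on (cts p) (\<lambda>f. c f * d f)"
      by (intro continuous_on_mult charactersD(3) that)
    then show "continuous_on (cts p) (\<lambda>f\<in>cts p. c f * d f)" by (rule continuous_on_eq) simp
    fix f assume f: "f \<in> cts p"
    then show "norm ((\<lambda>f\<in>cts p. c f * d f) f) = 1"
      using charactersD(1)[OF that(1) f] charactersD(1)[OF that(2) f] by (simp add: norm_mult)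
    fix h assume h: "h \<in> cts p"
    show "(\<lambda>f\<in>cts p. c f * d f) (\<lambda>x. f x + h x) = (\<lambda>f\<in>cts p. c f * d f) f * (\<lambda>f\<in>cts p. c f * d f) h"
      using charactersD(2)[OF that(1) f h] charactersD(2)[OF that(2) f h] f h by simp
  qed simp
  have "continuous_map (gtop ?D) (top_of_set (sphere 0 1)) (evaluation (cgrp p) g)"
    unfolding continuous_map
  proof (intro conjI allI impI)
    show "evaluation (cgrp p) g ` topspace (gtop ?D) \<subseteq> topspace (top_of_set (sphere 0 1))"
      using charactersD(1) g by (auto simp: evaluation_apply)
    fix U assume "openin (top_of_set (sphere (0::complex) 1)) U"
    moreover have "{c \<in> topspace (gtop ?D). evaluation (cgrp p) g c \<in> U} = {c \<in> characters (cgrp p). c ` {g} \<subseteq> U}"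
      by (auto simp: evaluation_apply)
    ultimately show "openin (gtop ?D) {c \<in> topspace (gtop ?D). evaluation (cgrp p) g c \<in> U}"
      using g openin_dual_basic[of "cgrp p" "{g}" U] by simp
  qed
  moreover have "evaluation (cgrp p) g \<in> hom ?D circle_group"
    using charactersD(1) g mult by (auto simp: hom_def evaluation_apply)
  moreover have "evaluation (cgrp p) g \<in> extensional (carrier ?D)"
    unfolding evaluation_def by simp
  ultimately show ?thesis unfolding characters_def[of ?D] by simp
qed

lemma evaluation_chi:
  "g \<in> cts p \<Longrightarrow> evaluation (cgrp p) g (chi p {x} (\<lambda>_. t)) = cis (t * of_int (g x))"
  by (simp add: evaluation_apply chi_character)

lemma evaluation_surj:
  assumes \<psi>: "\<psi> \<in> characters (dual_group (cgrp p))"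
  shows "\<psi> \<in> evaluation (cgrp p) ` cts p"
proof -
  obtain n where n: "\<And>F \<theta>. finite F \<Longrightarrow> \<psi> (chi p F \<theta>) = cis (\<Sum>x\<in>F. \<theta> x * of_int (n x))"
    using bidual_coordinate[OF \<psi>] by metis
  have cts: "n \<in> cts p" by (rule bidual_coordinate_cts[OF \<psi> n])
  have "\<psi> = evaluation (cgrp p) n"
  proof (rule extensionalityI[of _ "characters (cgrp p)"])
    show "\<psi> \<in> extensional (characters (cgrp p))" by (rule dual_charactersD(4)[OF \<psi>])
    show "evaluation (cgrp p) n \<in> extensional (characters (cgrp p))"
      unfolding evaluation_def by simp
    fix c assume c: "c \<in> characters (cgrp p)"
    then obtain F \<theta> where "finite F" "c = chi p F \<theta>" by (rule character_eq_chi)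
    then show "\<psi> c = evaluation (cgrp p) n c" using c cts n by (simp add: evaluation_apply)
  qed
  with cts show ?thesis by blast
qed

lemma evaluation_inj: "inj_on (evaluation (cgrp p)) (cts p)"
proof (rule inj_onI, rule ccontr)
  fix g h assume gh: "g \<in> cts p" "h \<in> cts p" "evaluation (cgrp p) g = evaluation (cgrp p) h" "g \<noteq> h"
  then obtain x where "g x \<noteq> h x" by blast
  \<comment> \<open>Chosen so that the angles for \<open>g\<close> and \<open>h\<close> differ by
    exactly pi.\<close>
  define t where "t = pi / of_int (g x - h x)"
  have "cis (t * of_int (g x)) = cis (t * of_int (h x))"
    using evaluation_chi[OF gh(1), of x t] evaluation_chi[OF gh(2), of x t] gh(3) by simp
  then have "cis (t * of_int (g x)) * cis (- (t * of_int (h x))) = 1" by (simp add: cis_mult)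
  then have "cis (t * of_int (g x - h x)) = 1" by (simp add: cis_mult algebra_simps)
  moreover have "t * of_int (g x - h x) = pi" unfolding t_def using \<open>g x \<noteq> h x\<close> by simp
  ultimately show False by simp
qed

text \<open>If \<open>g x \<noteq> k\<close>, then \<open>t g x\<close> and \<open>t k\<close> are antipodal on the circle for some \<open>t \<in> {0..pi}\<close>; cutting
  \<open>{0..2 * pi}\<close> into short arcs makes this visible in the compact-open topology.\<close>

lemma open_evaluation_cylinder:
  "openin (gtop (dual_group (dual_group (cgrp p)))) (evaluation (cgrp p) ` {g \<in> cts p. g x = k})"
proof -
  let ?D = "dual_group (cgrp p)"
  \<comment> \<open>Fine enough that \<open>t * k\<close> moves by less than 1 while
    \<open>t\<close> runs through one arc of length 2 pi / N.\<close>
  obtain N :: nat where N: "2 * pi * \<bar>of_int k\<bar> < real N" using reals_Archimedean2 by blast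
  then have "0 < N" by (metis abs_ge_zero less_le_trans mult_nonneg_nonneg not_gr_zero of_nat_0 
        pi_ge_zero zero_le_numeral not_less)
  define \<tau> where "\<tau> j = 2 * pi * real j / real N" for j
  define A where "A j = (\<lambda>t. chi p {x} (\<lambda>_. t)) ` {\<tau> j..\<tau> (Suc j)}" for j
  define U where "U j = sphere 0 1 \<inter> ball (cis (\<tau> j * of_int k)) 1" for j
  have "openin (gtop (dual_group ?D)) {\<psi> \<in> characters ?D. \<psi> ` A j \<subseteq> U j}" for j
  proof (rule openin_dual_basic)
    show "compactin (gtop ?D) (A j)"
      unfolding A_def by (rule image_compactin[OF _ continuous_map_chi_line]) simp
    show "openin (gtop circle_group) (U j)" unfolding U_def by (simp add: openin_open_Int)
  qed
  then have "openin (gtop (dual_group ?D)) (\<Inter>j\<in>{..<N}. {\<psi> \<in> characters ?D. \<psi> ` A j \<subseteq> U j})"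
    using \<open>0 < N\<close> by (intro openin_INT2) auto
  moreover have "(\<Inter>j\<in>{..<N}. {\<psi> \<in> characters ?D. \<psi> ` A j \<subseteq> U j}) = evaluation (cgrp p) ` {g \<in> cts p. g x = k}"
    (is "?I = ?E")
  proof
    have small_step: "dist (cis (t * of_int k)) (cis (\<tau> j * of_int k)) < 1"
      if "t \<in> {\<tau> j..\<tau> (Suc j)}" for t j
    proof -
      have "\<tau> (Suc j) - \<tau> j = 2 * pi / real N"
        unfolding \<tau>_def using \<open>0 < N\<close> by (simp add: field_simps)
      then have "\<bar>t - \<tau> j\<bar> \<le> 2 * pi / real N" using that by auto
      then have "\<bar>t - \<tau> j\<bar> * \<bar>of_int k\<bar> \<le> 2 * pi / real N * \<bar>of_int k\<bar>"
        by (rule mult_right_mono) simp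
      also have "\<dots> < 1" using N \<open>0 < N\<close> by (simp add: field_simps)
      finally have "\<bar>t * of_int k - \<tau> j * of_int k\<bar> < 1"
        by (simp add: left_diff_distrib[symmetric] abs_mult)
      then show ?thesis using dist_cis[of "t * of_int k" "\<tau> j * of_int k"] by linarith
    qed
    show "?E \<subseteq> ?I"
    proof
      fix \<psi> assume "\<psi> \<in> ?E"
      then obtain g where g: "g \<in> cts p" "g x = k" "\<psi> = evaluation (cgrp p) g" by blast
      have "\<psi> ` A j \<subseteq> U j" for j
        unfolding A_def U_def using small_step[of _ j] g(1,2)
        by (auto simp: g(3) evaluation_chi dist_commute)
      then show "\<psi> \<in> ?I" using evaluation_character[OF g(1)] g(3) by simp
    qed
    show "?I \<subseteq> ?E"
    proof
      fix \<psi> assume \<psi>: "\<psi> \<in> ?I"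
      then have "\<psi> \<in> characters ?D" using \<open>0 < N\<close> by blast
      then obtain g where g: "g \<in> cts p" "\<psi> = evaluation (cgrp p) g"
        using evaluation_surj[of \<psi> p] by auto
      have "g x = k"
      proof (rule ccontr)
        assume "g x \<noteq> k"
        define l where "l = \<bar>real_of_int (g x - k)\<bar>"
        have "1 \<le> l" unfolding l_def using \<open>g x \<noteq> k\<close> by linarith
        \<comment> \<open>The difference is a nonzero integer, so \<open>l\<close> is at least 1 and
          \<open>t\<close> at most pi; this keeps the arc index below \<open>N\<close>.\<close>
        define t where "t = pi / l"
        have t: "0 < t" "t \<le> pi" unfolding t_def using \<open>1 \<le> l\<close> by (auto simp: divide_le_eq)
        define j where "j = nat \<lfloor>t * real N / (2 * pi)\<rfloor>"
        have fl: "real j \<le> t * real N / (2 * pi)" "t * real N / (2 * pi) < real j + 1"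
          unfolding j_def using t \<open>0 < N\<close> by (auto simp: of_nat_nat)
        have j: "t \<in> {\<tau> j..\<tau> (Suc j)}"
          unfolding \<tau>_def using fl \<open>0 < N\<close> by (auto simp: field_simps)
        have "t * real N / (2 * pi) < real N" using t \<open>0 < N\<close> by (simp add: field_simps)
        then have "j < N" using fl(1) by linarith
        have tg: "cis (t * of_int (g x)) = - cis (t * of_int k)"
        proof -
          have "t * of_int (g x) = t * of_int k + pi \<or> t * of_int (g x) = t * of_int k - pi"
            unfolding t_def l_def using \<open>g x \<noteq> k\<close> by (auto simp: field_simps abs_if)
          then show ?thesis using minus_cis[of "t * of_int k - pi"] minus_cis[of "t * of_int k"]
            by (metis add_diff_cancel_right' diff_add_cancel minus_equation_iff)
        qed
        have "\<psi> (chi p {x} (\<lambda>_. t)) \<in> U j" using \<psi> \<open>j < N\<close> j unfolding A_def by blast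
        then have "dist (cis (\<tau> j * of_int k)) (- cis (t * of_int k)) < 1"
          unfolding U_def g(2) by (simp add: evaluation_chi[OF g(1)] tg)
        \<comment> \<open>Both points are within distance 1 of
          \<open>cis (\<tau> j * of_int k)\<close>, which antipodal points at distance 2 cannot
          be.\<close>
        moreover have "dist (cis (t * of_int k)) (- cis (t * of_int k)) = 2"
          unfolding dist_norm by (simp flip: mult_2 add: norm_mult)
        ultimately show False
          using small_step[OF j] dist_triangle[of "cis (t * of_int k)" "- cis (t * of_int k)" "cis (\<tau> j * of_int k)"]
          by linarith
      qed
      then show "\<psi> \<in> ?E" using g by blast
    qed
  qed
  ultimately show ?thesis by simp
qed

text \<open>A compact set of characters with finite joint support cannot separate functions that
  agree there, which gives continuity. Openness holds because basic open sets are finite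
  intersections of cylinders with open images, and injectivity lets images commute with
  intersections.\<close>

lemma pontryagin_reflexive_cgrp: "pontryagin_reflexive (cgrp p)"
proof -
  let ?G = "cgrp p" and ?D = "dual_group (cgrp p)"
  let ?E = "evaluation ?G"
  have image: "?E ` cts p = characters ?D"
    using evaluation_character[of _ p] evaluation_surj[of _ p] by auto
  have "?E \<in> hom ?G (dual_group ?D)"
  proof (rule homI)
    show "?E g \<in> carrier (dual_group ?D)" if "g \<in> carrier ?G" for g
      using that evaluation_character by simp
    show "?E (mult ?G g h) = mult (dual_group ?D) (?E g) (?E h)"
      if "g \<in> carrier ?G" "h \<in> carrier ?G" for g h
      using that charactersD(2)[of _ p g h] by (auto simp: evaluation_def)
  qed
  then have "?E \<in> iso ?G (dual_group ?D)"
    using evaluation_inj image by (auto simp: iso_def bij_betw_def)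
  moreover have "homeomorphic_map (gtop ?G) (gtop (dual_group ?D)) ?E"
  proof (rule bijective_open_imp_homeomorphic_map)
    show "?E ` topspace (gtop ?G) = topspace (gtop (dual_group ?D))" using image by simp
    show "inj_on ?E (topspace (gtop ?G))" using evaluation_inj by simp
    show "continuous_map (gtop ?G) (gtop (dual_group ?D)) ?E"
    proof (rule continuous_map_into_dual)
      show "?E g \<in> characters ?D" if "g \<in> topspace (gtop ?G)" for g
        using that evaluation_character by simp
    next
      fix C U assume C: "compactin (gtop ?D) C"
      obtain F where F: "finite F"
        "\<And>c f. c \<in> C \<Longrightarrow> f \<in> cts p \<Longrightarrow> (\<And>x. x \<in> F \<Longrightarrow> f x = 0) \<Longrightarrow> c f = 1"
        using dual_compact_finite_support[OF C] by metis
      have CD: "C \<subseteq> characters ?G" using compactin_subset_topspace[OF C] by simp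
      define V where "V = {g \<in> cts p. ?E g ` C \<subseteq> U}"
      have "\<exists>W. openin (top_of_set (cts p)) W \<and> g \<in> W \<and> W \<subseteq> V" if g: "g \<in> V" for g
      proof -
        define W where "W = {h. \<forall>x\<in>F. h x = g x}"
        have "open (\<Inter>x\<in>F. {h. h x = g x})"
          by (intro open_INT F(1) ballI open_coordinate_value)
        moreover have "W = (\<Inter>x\<in>F. {h. h x = g x})" unfolding W_def by auto
        ultimately have "open W" by simp
        then have "openin (top_of_set (cts p)) (cts p \<inter> W)" by (rule openin_open_Int)
        moreover have "cts p \<inter> W \<subseteq> V"
        proof
          fix h assume h: "h \<in> cts p \<inter> W"
          have "c h = c g" if c: "c \<in> C" for c
          proof -
            have "c (\<lambda>x. h x - g x) = 1"
              using h g by (intro F(2)[OF c]) (auto simp: W_def V_def)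
            moreover have "c (\<lambda>x. (h x - g x) + g x) = c (\<lambda>x. h x - g x) * c g"
              using h g c CD by (intro charactersD(2)[of c p]) (auto simp: V_def)
            ultimately show ?thesis by simp
          qed
          then have "?E h ` C = ?E g ` C"
            using CD by (intro image_cong) (auto simp: evaluation_apply subset_iff)
          then show "h \<in> V" using h g unfolding V_def by simp
        qed
        moreover have "g \<in> cts p \<inter> W" using g unfolding V_def W_def by simp
        ultimately show ?thesis by blast
      qed
      then have "openin (top_of_set (cts p)) V" by (subst openin_subopen) blast
      then show "openin (gtop ?G) {g \<in> topspace (gtop ?G). ?E g ` C \<subseteq> U}"
        unfolding V_def by simp
    qed
    show "open_map (gtop ?G) (gtop (dual_group ?D)) ?E"
      unfolding open_map_def
    proof (intro allI impI)
      fix W assume "openin (gtop ?G) W"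
      then obtain O' where O: "open O'" "W = cts p \<inter> O'" by (auto simp: openin_open)
      show "openin (gtop (dual_group ?D)) (?E ` W)"
      proof (subst openin_subopen, intro ballI)
        fix \<psi> assume "\<psi> \<in> ?E ` W"
        then obtain g where g: "g \<in> cts p" "g \<in> O'" "\<psi> = ?E g" using O by blast
        obtain F where F: "finite F" "\<And>h. (\<And>x. x \<in> F \<Longrightarrow> h x = g x) \<Longrightarrow> h \<in> O'"
          using open_fun_cylinder[OF O(1) g(2)] by metis
        \<comment> \<open>The factor \<open>topspace\<close> matters for empty \<open>F\<close>,
          where the intersection alone would be the whole type.\<close>
        let ?T = "(\<Inter>x\<in>F. ?E ` {h \<in> cts p. h x = g x}) \<inter> topspace (gtop (dual_group ?D))"
        have "openin (gtop (dual_group ?D)) ?T"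
          by (intro openin_INT F(1) open_evaluation_cylinder)
        moreover have "\<psi> \<in> ?T" using g evaluation_character by auto
        moreover have "?T \<subseteq> ?E ` W"
        proof
          fix \<phi> assume \<phi>: "\<phi> \<in> ?T"
          then obtain h where h: "h \<in> cts p" "\<phi> = ?E h" using evaluation_surj[of \<phi> p] by auto
          have "h x = g x" if xF: "x \<in> F" for x
          proof -
            obtain h' where "h' \<in> cts p" "h' x = g x" "?E h = ?E h'" using \<phi> xF h(2) by blast
            then show ?thesis using inj_onD[OF evaluation_inj, of p h h'] h(1) by auto
          qed
          then show "\<phi> \<in> ?E ` W" using h F(2) O(2) by blast
        qed
        ultimately show "\<exists>T. openin (gtop (dual_group ?D)) T \<and> \<psi> \<in> T \<and> T \<subseteq> ?E ` W" by blast
      qed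
    qed
  qed
  ultimately show ?thesis unfolding pontryagin_reflexive_def by blast
qed

theorem theoremC:
  shows "\<exists>X :: nat set set topology.
           tikhonov_space X \<and> zero_dimensional X \<and>
           X \<noteq> discrete_topology (topspace X) \<and>
           top_ab_group (Cp_int X) \<and> pontryagin_reflexive (Cp_int X)"
  \<comment> \<open>The choice of \<open>{}\<close> as the non-isolated point is arbitrary; only the
    cardinality of the type counts.\<close>
  by (intro exI[of _ "cosmall_topology {}"] conjI tikhonov_cosmall zero_dimensional_cosmall
      nondiscrete_cosmall not_small_UNIV top_ab_group_cgrp pontryagin_reflexive_cgrp)

end
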